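(* Let $N\ge 2$ be an integer, let $\rho>0$, and let $0\le\gamma\le 1$. Let $S_n$ be the cumulative profit after $n$ turns to the ensemble of $N$ players playing the mixed game $\gamma A'+(1-\gamma)B$ (as defined in the context), with arbitrary initial capitals. Then the following hold. (i) If $\gamma=1$, then $\mathrm{P}(S_n=0\text{ for all }n\ge1)=1$. (ii) If $\gamma=0$, then $S_n/n\to 0$ almost surely and $S_n/\sqrt{n\,(\sigma_B^{(N)})^2}\to_d N(0,1)$ as $n\to\infty$, where $$(\sigma_B^{(N)})^2=\left(\frac{3\rho}{1+\rho+\rho^2}\right)^2.$$ (iii) If $0<\gamma<1$, then $S_n/n\to\mu_{(\gamma,1-\gamma)}^{(N)}$ almost surely as $n\to\infty$, where $$\mu_{(\gamma,1-\gamma)}^{(N)}=\frac{3\gamma(1-\gamma)(1-\rho)^3(1+\rho)}{2(1+\rho+\rho^2)^2+\gamma(5+10\rho+6\rho^2+10\rho^3+5\rho^4)+2\gamma^2(1+\rho+\rho^2)^2},$$ and, if the variance parameter $(\sigma_{(\gamma,1-\gamma)}^{(N)})^2$ (defined in the context) is positive, then $$\frac{S_n-n\mu_{(\gamma,1-\gamma)}^{(N)}}{\sqrt{n(\sigma_{(\gamma,1-\gamma)}^{(N)})^2}}\to_d N(0,1).$$ Moreover, when $\rho=1/3$ and $\gamma=1/2$, the variance parameter is given by $$(\sigma_{(1/2,1/2)}^{(N)})^2=\frac{27\,(-36821493886409+71724260647553N-46282959184439N^2+9902542819695N^3)}{8331019058\,(-269171+524347N-338381N^2+72405N^3)},$$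 and the central limit theorem above holds in this case without further assumption.
   Context: The model. There are $N\ge2$ players, each having an integer capital. Put $$p_0:=\frac{\rho^2}{1+\rho^2},\qquad p_1=p_2:=\frac1{1+\rho},\qquad q_j:=1-p_j\quad(j=0,1,2).$$ Game $B$: one of the $N$ players is selected uniformly at random; if his current capital is congruent to $j$ (mod 3), $j\in\{0,1,2\}$, he wins one unit with probability $p_j$ and loses one unit with probability $q_j$. Game $A'$: two distinct players are selected uniformly at random without replacement, and the first transfers one unit of his capital to the second. Mixed game $\gamma A'+(1-\gamma)B$: at each turn, independently of the past, game $A'$ is played with probability $\gamma$ and game $B$ is played with probability $1-\gamma$. $S_n$ (with $S_0:=0$) is the total change in the sum of all $N$ players' capitals over the first $n$ turns. Thus each play of $B$ changes $S_n$ by $+1$ (win) or $-1$ (loss), and each play of $A'$ changes it by $0$. The vector of capitals mod 3 is a Markov chain in $\Sigma_N:=\{0,1,2\}^N$ with one-step transition matrix $\boldsymbol P:=\gamma\boldsymbol P_{A'}^{(N)}+(1-\gamma)\boldsymbol P_B^{(N)}$. Here $\boldsymbol P_B^{(N)}(\boldsymbol x,\boldsymbol y)=N^{-1}p_{x_i}$ if $y_i=x_i+1$ (mod 3) and $y_j=x_j$ for $j\ne i$; $\boldsymbol P_B^{(N)}(\boldsymbol x,\boldsymbol y)=N^{-1}q_{x_i}$ if $y_i=x_i-1$ (mod 3) and $y_j=x_j$ for $j\neq i$; and it is $0$ otherwise. Also $\boldsymbol P_{A'}^{(N)}(\boldsymbol x,\boldsymbol y)=[N(N-1)]^{-1}$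 if for some $i\ne j$ we have $y_i=x_i-1$ (mod 3), $y_j=x_j+1$ (mod 3), and $y_k=x_k$ for $k\ne i,j$; and it is $0$ otherwise. For $0\le\gamma<1$ this chain is irreducible and aperiodic. Variance parameter. For $0<\gamma<1$, let $\boldsymbol\pi$ be the unique stationary distribution of $\boldsymbol P$ (a row vector), $\boldsymbol\Pi$ the square matrix each of whose rows is $\boldsymbol\pi$, $\boldsymbol Z:=(\boldsymbol I-(\boldsymbol P-\boldsymbol\Pi))^{-1}$, and $\boldsymbol 1$ the column vector of ones. Let $\boldsymbol W$ be the payoff matrix with $\boldsymbol W(\boldsymbol x,\boldsymbol y)=1$ (resp. $-1$) if $\boldsymbol y$ differs from $\boldsymbol x$ in exactly one coordinate $i$ and $y_i=x_i+1$ (resp. $y_i=x_i-1$) (mod 3), and $0$ otherwise. With $\circ$ denoting the entrywise product, let $\dot{\boldsymbol P}:=\boldsymbol P\circ\boldsymbol W$ and $\ddot{\boldsymbol P}:=\boldsymbol P\circ\boldsymbol W\circ\boldsymbol W$. Then $$(\sigma_{(\gamma,1-\gamma)}^{(N)})^2:=\boldsymbol\pi\ddot{\boldsymbol P}\boldsymbol 1-(\boldsymbol\pi\dot{\boldsymbol P}\boldsymbol 1)^2+2\boldsymbol\pi\dot{\boldsymbol P}(\boldsymbol Z-\boldsymbol\Pi)\dot{\boldsymbol P}\boldsymbol 1.$$ $\to_d$ denotes convergence in distribution and $N(0,1)$ the standard normal law. *)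

theory Defs
  imports "HOL-Probability.Probability"
begin

text \<open>
  The players are the elements of a finite type \<open>'n\<close>, so that \<open>N = CARD('n)\<close>. Residues modulo 3 are
  the elements of the numeral type \<open>3\<close>, whose arithmetic is modular; \<open>of_int\<close> is the reduction map.
\<close>

definition win_prob :: "real \<Rightarrow> 3 \<Rightarrow> real" where
  "win_prob \<rho> j = (if j = 0 then \<rho>\<^sup>2 / (1 + \<rho>\<^sup>2) else 1 / (1 + \<rho>))"

definition lose_prob :: "real \<Rightarrow> 3 \<Rightarrow> real" where
  "lose_prob \<rho> j = 1 - win_prob \<rho> j"


subsection \<open>The games, as random updates of the vector of capitals\<close>

definition game_B :: "real \<Rightarrow> ('n::finite \<Rightarrow> int) \<Rightarrow> ('n \<Rightarrow> int) pmf" where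
  "game_B \<rho> c =
     bind_pmf (pmf_of_set UNIV) (\<lambda>i.
     bind_pmf (bernoulli_pmf (win_prob \<rho> (of_int (c i)))) (\<lambda>win.
       return_pmf (c(i := c i + (if win then 1 else - 1)))))"

definition game_A' :: "('n::finite \<Rightarrow> int) \<Rightarrow> ('n \<Rightarrow> int) pmf" where
  "game_A' c =
     bind_pmf (pmf_of_set {(i, j). i \<noteq> j}) (\<lambda>(i, j).
       return_pmf (c(i := c i - 1, j := c j + 1)))"

definition mixed_game :: "real \<Rightarrow> real \<Rightarrow> ('n::finite \<Rightarrow> int) \<Rightarrow> ('n \<Rightarrow> int) pmf" where
  "mixed_game \<rho> \<gamma> c =
     bind_pmf (bernoulli_pmf \<gamma>) (\<lambda>play_A'. if play_A' then game_A' c else game_B \<rho> c)"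

text \<open>
  \<open>X\<close> is a time-homogeneous Markov chain on \<open>M\<close> with transition kernel \<open>K\<close>. The law of \<open>X 0\<close> is
  not restricted. The equation is the Markov property with the conditional probability multiplied
  out, so that it also makes sense for histories of probability 0.
\<close>

definition markov_chain_on :: "'w measure \<Rightarrow> ('s::countable \<Rightarrow> 's pmf) \<Rightarrow> (nat \<Rightarrow> 'w \<Rightarrow> 's) \<Rightarrow> bool" where
  "markov_chain_on M K X \<longleftrightarrow>
     prob_space M \<and>
     (\<forall>n. X n \<in> M \<rightarrow>\<^sub>M count_space UNIV) \<and>
     (\<forall>n x. measure M {\<omega> \<in> space M. \<forall>k\<le>Suc n. X k \<omega> = x k} =
        measure M {\<omega> \<in> space M. \<forall>k\<le>n. X k \<omega> = x k} * pmf (K (x n)) (x (Suc n)))"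

definition total_profit :: "(nat \<Rightarrow> 'w \<Rightarrow> 'n::finite \<Rightarrow> int) \<Rightarrow> nat \<Rightarrow> 'w \<Rightarrow> real" where
  "total_profit C n \<omega> = real_of_int ((\<Sum>i\<in>UNIV. C n \<omega> i) - (\<Sum>i\<in>UNIV. C 0 \<omega> i))"


subsection \<open>The chain of capitals modulo 3 and the variance parameter\<close>

text \<open>
  For given \<open>x\<close> and \<open>y\<close> at most one summand is nonzero, since \<open>1 \<noteq> - 1\<close> modulo 3 and \<open>y\<close> differs from
  \<open>x\<close> in at most one coordinate.
\<close>

definition P_B :: "real \<Rightarrow> real^('n::finite \<Rightarrow> 3)^('n \<Rightarrow> 3)" where
  "P_B \<rho> = (\<chi> x y. \<Sum>i\<in>UNIV.
     if y i = x i + 1 \<and> (\<forall>j. j \<noteq> i \<longrightarrow> y j = x j) then win_prob \<rho> (x i) / real CARD('n)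
     else if y i = x i - 1 \<and> (\<forall>j. j \<noteq> i \<longrightarrow> y j = x j) then lose_prob \<rho> (x i) / real CARD('n)
     else 0)"

definition P_A' :: "real^('n::finite \<Rightarrow> 3)^('n \<Rightarrow> 3)" where
  "P_A' = (\<chi> x y.
     if \<exists>i j. i \<noteq> j \<and> y i = x i - 1 \<and> y j = x j + 1 \<and> (\<forall>k. k \<noteq> i \<and> k \<noteq> j \<longrightarrow> y k = x k)
     then 1 / (real CARD('n) * (real CARD('n) - 1)) else 0)"

definition P_mixed :: "real \<Rightarrow> real \<Rightarrow> real^('n::finite \<Rightarrow> 3)^('n \<Rightarrow> 3)" where
  "P_mixed \<rho> \<gamma> = \<gamma> *\<^sub>R P_A' + (1 - \<gamma>) *\<^sub>R P_B \<rho>"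

definition payoff :: "real^('n::finite \<Rightarrow> 3)^('n \<Rightarrow> 3)" where
  "payoff = (\<chi> x y.
     if \<exists>i. y i = x i + 1 \<and> (\<forall>j. j \<noteq> i \<longrightarrow> y j = x j) then 1
     else if \<exists>i. y i = x i - 1 \<and> (\<forall>j. j \<noteq> i \<longrightarrow> y j = x j) then - 1
     else 0)"

definition stationary :: "real^'s^'s \<Rightarrow> real^'s \<Rightarrow> bool" where
  "stationary P \<pi> \<longleftrightarrow> (\<forall>x. 0 \<le> \<pi> $ x) \<and> (\<Sum>x\<in>UNIV. \<pi> $ x) = 1 \<and> \<pi> v* P = \<pi>"

definition stationary_dist :: "real^'s^'s \<Rightarrow> real^'s" where
  "stationary_dist P = (THE \<pi>. stationary P \<pi>)"

definition fundamental_matrix :: "real^'s^'s \<Rightarrow> real^'s^'s" where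
  "fundamental_matrix P = matrix_inv (mat 1 - (P - (\<chi> x. stationary_dist P)))"

text \<open>
  On \<open>real^'s^'s\<close>, \<open>*\<close> is the entrywise product and \<open>**\<close> the matrix product; \<open>1 :: real^'s\<close> is the
  vector of ones.
\<close>

definition chain_variance :: "real^'s^'s \<Rightarrow> real^'s^'s \<Rightarrow> real" where
  "chain_variance P W =
     (let \<pi> = stationary_dist P; \<pi>s = (\<chi> x. \<pi>); Z = fundamental_matrix P;
          P' = P * W; P'' = P * W * W
      in \<pi> \<bullet> (P'' *v 1) - (\<pi> \<bullet> (P' *v 1))\<^sup>2 + 2 * (\<pi> \<bullet> ((P' ** (Z - \<pi>s) ** P') *v 1)))"

definition mixed_variance :: "'n::finite itself \<Rightarrow> real \<Rightarrow> real \<Rightarrow> real" where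
  "mixed_variance _ \<rho> \<gamma> = chain_variance (P_mixed \<rho> \<gamma> :: real^('n \<Rightarrow> 3)^('n \<Rightarrow> 3)) payoff"

definition mixed_mean :: "real \<Rightarrow> real \<Rightarrow> real" where
  "mixed_mean \<rho> \<gamma> =
     3 * \<gamma> * (1 - \<gamma>) * (1 - \<rho>)^3 * (1 + \<rho>) /
     (2 * (1 + \<rho> + \<rho>\<^sup>2)\<^sup>2 + \<gamma> * (5 + 10 * \<rho> + 6 * \<rho>\<^sup>2 + 10 * \<rho>^3 + 5 * \<rho>^4)
      + 2 * \<gamma>\<^sup>2 * (1 + \<rho> + \<rho>\<^sup>2)\<^sup>2)"

end

theory Submission
  imports Defs "HOL-Real_Asymp.Real_Asymp"
begin

text \<open>
  Both limit theorems come from Poisson equations for the chain of residues. If \<open>h\<close> solves the equation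
  for the drift, then \<open>S\<^sub>n - n \<mu> + h(X\<^sub>n) - h(X\<^sub>0)\<close> is a martingale with bounded increments: exponential
  moments and Borel--Cantelli give the strong law. If moreover \<open>g\<close> solves the equation for the
  conditional variance of the increments, with constant \<open>v\<close>, then multiplying \<open>exp (i s M\<^sub>n)\<close> by the
  corrector \<open>1 - s\<^sup>2 g(X\<^sub>n) / 2\<close> turns its expectation into a geometric sequence with ratio
  \<open>1 - s\<^sup>2 v / 2\<close>, up to an error \<open>O(s\<^sup>3)\<close> per step. With \<open>s = t / sqrt (n v)\<close> this gives the
  characteristic function of the normal law.

  Sums over the players of a function of one residue are mapped by the transition operator to sums of
  the same kind, so the drift equation is a 3 by 3 system that does not involve \<open>N\<close>. The conditional
  variance is a sum over pairs of players, and sums over pairs are again preserved; this gives the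
  explicit \<open>g\<close>, rational in \<open>N\<close>, behind the closed formula for the variance at \<open>\<rho> = 1/3\<close>, \<open>\<gamma> = 1/2\<close>. For
  general parameters \<open>g\<close> exists because the chain is irreducible.
\<close>

section \<open>Endpoint laws of a Markov chain\<close>

text \<open>The profit telescopes to a difference of capitals, so both limit laws concern only the
  pair of the initial and the current state. Its law obeys a recursion on pmfs, and every moment is
  computed by induction on the time. Capitals are unbounded and the initial law is arbitrary, so
  only functions of increments are averaged.

  The conditional variance of an increment depends on the residues, so the characteristic function
  does not factor over time. By the equation for \<open>g\<close>, the one-step change of the
  corrector cancels the state-dependent part of the second-order term; what remains is a boundary
  term of order \<open>s\<^sup>2\<close> at each end.

  Game \<open>B\<close> moves one player but game \<open>A'\<close> moves two, so the squared
  increment couples two residues; this leads from sums over players to sums over pairs.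

  The link to the matrix definition of the variance is invariance: averaging the equation for
  \<open>g\<close> against the stationary distribution removes \<open>g\<close> and leaves
  \<open>v\<close>. Hence any solution, found in whatever way, identifies the variance parameter,
  and a solution in closed form does so for all numbers of players at once.\<close>

text \<open>The points of mass zero form a countable union of null singletons, so almost every point
  carries mass; this is what makes a probability measure on the full power set a pmf.\<close>

lemma prob_space_countable_pmf:
  fixes X :: "'w \<Rightarrow> 's::countable"
  assumes "prob_space M" and X: "X \<in> M \<rightarrow>\<^sub>M count_space UNIV"
  obtains p where "distr M (count_space UNIV) X = measure_pmf p"
proof -
  let ?D = "distr M (count_space UNIV) X"
  interpret prob_space M by fact
  interpret D: prob_space ?D by (rule prob_space_distr[OF X])
  have "AE x in ?D. measure ?D {x} \<noteq> 0"
  proof (rule AE_I)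
    show "{x \<in> space ?D. \<not> measure ?D {x} \<noteq> 0} \<subseteq> (\<Union>x\<in>{x. measure ?D {x} = 0}. {x})" by auto
    have "(\<Union>x\<in>{x. measure ?D {x} = 0}. {x}) \<in> null_sets ?D"
      by (rule null_sets_UN') (auto simp: null_sets_def D.emeasure_eq_measure)
    then show "emeasure ?D (\<Union>x\<in>{x. measure ?D {x} = 0}. {x}) = 0" by auto
  qed auto
  then have "measure_pmf (Abs_pmf ?D) = ?D"
    by (intro Abs_pmf_inverse) (auto intro: D.prob_space_axioms)
  then show ?thesis using that by metis
qed

text \<open>The Markov property is stated for entire histories, while the later inductions need only
  the joint law of the first and the current state. The law of the history satisfies a recursion,
  and its image under first and last element inherits it.\<close>

lemma markov_chain_endpoints:
  fixes X :: "nat \<Rightarrow> 'w \<Rightarrow> 's::countable"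
  assumes mc: "markov_chain_on M K X"
  obtains r where "\<And>n. distr M (count_space UNIV) (\<lambda>\<omega>. (X 0 \<omega>, X n \<omega>)) = measure_pmf (r n)"
    and "set_pmf (r 0) \<subseteq> Id"
    and "\<And>n. r (Suc n) = bind_pmf (r n) (\<lambda>(a, b). map_pmf (Pair a) (K b))"
proof -
  have ps: "prob_space M" and X[measurable]: "\<And>n. X n \<in> M \<rightarrow>\<^sub>M count_space UNIV"
    and step: "\<And>n x. measure M {\<omega> \<in> space M. \<forall>k\<le>Suc n. X k \<omega> = x k} =
        measure M {\<omega> \<in> space M. \<forall>k\<le>n. X k \<omega> = x k} * pmf (K (x n)) (x (Suc n))"
    using mc by (auto simp: markov_chain_on_def)
  interpret prob_space M by fact
  \<comment> \<open>The history up to time \<open>n\<close> as a list of length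
    \<open>n + 1\<close>, so that the laws for all \<open>n\<close> live on one countable
    type.\<close>
  define H where "H n \<omega> = map (\<lambda>k. X k \<omega>) [0..<Suc n]" for n \<omega>
  have H_iff: "H n \<omega> = xs \<longleftrightarrow> length xs = Suc n \<and> (\<forall>k\<le>n. X k \<omega> = xs ! k)" for n \<omega> xs
    by (auto simp: H_def list_eq_iff_nth_eq less_Suc_eq_le simp del: upt_Suc)
  have H_meas: "H n \<in> M \<rightarrow>\<^sub>M count_space UNIV" for n
  proof (subst measurable_count_space_eq_countable, safe)
    show "H n -` {xs} \<inter> space M \<in> sets M" for xs
    proof (cases "length xs = Suc n")
      case True
      then have "H n -` {xs} \<inter> space M = {\<omega> \<in> space M. \<forall>k\<in>{..n}. X k \<omega> = xs ! k}"
        using H_iff[of n _ xs] by auto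
      then show ?thesis by simp
    next
      case False
      then have "H n -` {xs} \<inter> space M = {}" using H_iff[of n _ xs] by auto
      then show ?thesis by simp
    qed
  qed auto
  have "\<exists>q. distr M (count_space UNIV) (H n) = measure_pmf q" for n
    using prob_space_countable_pmf[OF ps H_meas[of n]] by metis
  then obtain q where q: "\<And>n. distr M (count_space UNIV) (H n) = measure_pmf (q n)" by metis
  have pmf_q: "pmf (q n) xs = measure M {\<omega> \<in> space M. H n \<omega> = xs}" for n xs
  proof -
    have "pmf (q n) xs = measure (distr M (count_space UNIV) (H n)) {xs}" by (simp add: q measure_pmf_single)
    also have "\<dots> = measure M (H n -` {xs} \<inter> space M)" by (rule measure_distr[OF H_meas]) simp
    also have "H n -` {xs} \<inter> space M = {\<omega> \<in> space M. H n \<omega> = xs}" by auto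
    finally show ?thesis .
  qed
  have pmf_q_len: "pmf (q n) xs = measure M {\<omega> \<in> space M. \<forall>k\<le>n. X k \<omega> = xs ! k}"
    if "length xs = Suc n" for n xs using that by (simp add: pmf_q H_iff)
  have len_q: "length xs = Suc n" if "xs \<in> set_pmf (q n)" for n xs
  proof (rule ccontr)
    assume "length xs \<noteq> Suc n"
    then have "pmf (q n) xs = 0" by (simp add: pmf_q H_iff)
    then show False using that by (simp add: set_pmf_iff)
  qed
  \<comment> \<open>Lists of a wrong length have mass zero on both sides. A list of length
    \<open>n + 2\<close> splits uniquely into a history and a new state, so the bind collapses to
    one product, which is the defining equation of the chain.\<close>
  have q_Suc: "q (Suc n) = bind_pmf (q n) (\<lambda>xs. map_pmf (\<lambda>y. xs @ [y]) (K (last xs)))" for n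
  proof (rule pmf_eqI)
    fix zs
    let ?b = "bind_pmf (q n) (\<lambda>xs. map_pmf (\<lambda>y. xs @ [y]) (K (last xs)))"
    show "pmf (q (Suc n)) zs = pmf ?b zs"
    proof (cases "length zs = Suc (Suc n)")
      case False
      have "zs \<notin> set_pmf (q (Suc n))" "zs \<notin> set_pmf ?b" using False len_q by auto
      then have "pmf (q (Suc n)) zs = 0" "pmf ?b zs = 0" by (simp_all only: pmf_eq_0_set_pmf not_False_eq_True)
      then show ?thesis by simp
    next
      case True
      then obtain ws z where zs: "zs = ws @ [z]" and len: "length ws = Suc n"
        by (metis length_Suc_conv_rev)
      have "pmf (map_pmf (\<lambda>y. xs @ [y]) (K (last xs))) zs = indicator {ws} xs * pmf (K (last ws)) z" for xs
      proof (cases "xs = ws")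
        case True
        have "inj (\<lambda>y. ws @ [y])" by (auto simp: inj_on_def)
        from pmf_map_inj'[OF this, of "K (last ws)" z] True show ?thesis by (simp add: zs)
      next
        case False
        then have "zs \<notin> set_pmf (map_pmf (\<lambda>y. xs @ [y]) (K (last xs)))" by (auto simp: zs)
        then have "pmf (map_pmf (\<lambda>y. xs @ [y]) (K (last xs))) zs = 0"
          by (simp only: pmf_eq_0_set_pmf not_False_eq_True)
        with False show ?thesis by simp
      qed
      then have "pmf ?b zs = pmf (q n) ws * pmf (K (last ws)) z"
        by (simp add: pmf_bind measure_pmf_single)
      also have "\<dots> = measure M {\<omega> \<in> space M. \<forall>k\<le>n. X k \<omega> = zs ! k} * pmf (K (zs ! n)) (zs ! Suc n)"
      proof -
        have "last ws = zs ! n" using len by (cases ws rule: rev_cases) (auto simp: zs nth_append)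
        moreover have "{\<omega> \<in> space M. \<forall>k\<le>n. X k \<omega> = ws ! k} = {\<omega> \<in> space M. \<forall>k\<le>n. X k \<omega> = zs ! k}"
          using len by (auto simp: zs nth_append)
        moreover have "zs ! Suc n = z" using len by (simp add: zs nth_append)
        ultimately show ?thesis using len by (simp add: pmf_q_len)
      qed
      also have "\<dots> = pmf (q (Suc n)) zs" using True by (simp add: pmf_q_len step)
      finally show ?thesis by simp
    qed
  qed
  define r where "r n = map_pmf (\<lambda>xs. (hd xs, last xs)) (q n)" for n
  show ?thesis
  proof
    fix n
    have e: "(\<lambda>\<omega>. (X 0 \<omega>, X n \<omega>)) = (\<lambda>xs. (hd xs, last xs)) \<circ> H n"
      by (auto simp: H_def fun_eq_iff hd_map last_map simp del: upt_Suc)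
        
    show "distr M (count_space UNIV) (\<lambda>\<omega>. (X 0 \<omega>, X n \<omega>)) = measure_pmf (r n)"
      unfolding e r_def map_pmf_rep_eq q[symmetric]
      by (subst distr_distr) (auto intro: H_meas)
    show "r (Suc n) = bind_pmf (r n) (\<lambda>(a, b). map_pmf (Pair a) (K b))"
      unfolding r_def q_Suc map_bind_pmf bind_map_pmf
      by (rule bind_pmf_cong) (auto simp: map_pmf_comp hd_append dest!: len_q intro!: map_pmf_cong)
    show "set_pmf (r 0) \<subseteq> Id"
      using len_q by (force simp: r_def length_Suc_conv)
  qed
qed

section \<open>The strong law\<close>

text \<open>The tower property for characteristic functions, reduced to the real case through real
  and imaginary parts.\<close>

lemma expectation_bind_pmf:
  fixes f :: "'a \<Rightarrow> complex"
  assumes f: "\<And>x. norm (f x) \<le> B"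
  shows "measure_pmf.expectation (bind_pmf p K) f = measure_pmf.expectation p (\<lambda>x. measure_pmf.expectation (K x) f)"
proof -
  have int: "integrable (measure_pmf q) f" for q
    by (rule measure_pmf.integrable_const_bound[where B = B]) (auto simp: f)
  have int': "integrable (measure_pmf q) (\<lambda>x. measure_pmf.expectation (K x) f)" for q
  proof (rule measure_pmf.integrable_const_bound[where B = B])
    show "AE x in measure_pmf q. norm (measure_pmf.expectation (K x) f) \<le> B"
      by (auto intro!: AE_I2 order_trans[OF integral_norm_bound] measure_pmf.integral_le_const integrable_norm int f)
  qed simp
  have real_case: "measure_pmf.expectation (bind_pmf p K) u = measure_pmf.expectation p (\<lambda>x. measure_pmf.expectation (K x) u)"
    if "\<And>x. \<bar>u x\<bar> \<le> B" for u :: "'a \<Rightarrow> real"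
    unfolding measure_pmf_bind
    by (rule integral_bind[where K = "count_space UNIV" and B = B and B' = 1])
       (auto simp: that space_subprob_algebra measure_pmf.subprob_space_axioms measure_pmf.finite_measure_axioms measure_pmf.emeasure_space_1)
  show ?thesis
  proof (rule complex_eqI)
    show "Re (measure_pmf.expectation (bind_pmf p K) f) = Re (measure_pmf.expectation p (\<lambda>x. measure_pmf.expectation (K x) f))"
      by (subst integral_Re[symmetric, OF int], subst integral_Re[symmetric, OF int'],
          subst real_case) (auto simp: integral_Re[OF int] intro: order_trans[OF abs_Re_le_cmod f])
    show "Im (measure_pmf.expectation (bind_pmf p K) f) = Im (measure_pmf.expectation p (\<lambda>x. measure_pmf.expectation (K x) f))"
      by (subst integral_Im[symmetric, OF int], subst integral_Im[symmetric, OF int'],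
          subst real_case) (auto simp: integral_Im[OF int] intro: order_trans[OF abs_Im_le_cmod f])
  qed
qed

text \<open>In the application \<open>U\<close> is the capital plus a bounded function of the
  residues that solves the drift equation. Only the increments of \<open>U\<close> are assumed
  bounded, since \<open>U\<close> itself is not.\<close>

locale additive_functional = prob_space M
  for M :: "'w measure" +
  fixes K :: "'s::countable \<Rightarrow> 's pmf" and X :: "nat \<Rightarrow> 'w \<Rightarrow> 's" and U :: "'s \<Rightarrow> real" and \<mu> d :: real
  assumes mc: "markov_chain_on M K X"
    and increment_le: "c' \<in> set_pmf (K c) \<Longrightarrow> \<bar>U c' - U c - \<mu>\<bar> \<le> d"
    and drift: "measure_pmf.expectation (K c) (\<lambda>c'. U c' - U c - \<mu>) = 0"
begin

lemma random_variable_X [measurable]: "X n \<in> M \<rightarrow>\<^sub>M count_space UNIV"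
  using mc by (simp add: markov_chain_on_def)

lemma d_nonneg: "0 \<le> d"
proof -
  obtain c' where "c' \<in> set_pmf (K undefined)" using set_pmf_not_empty by fast
  from increment_le[OF this] show ?thesis by linarith
qed

lemma exp_moment_step:
  assumes "0 < l"
  shows "(\<integral>\<^sup>+c'. ennreal (exp (l * (U c' - U c - \<mu>))) \<partial>measure_pmf (K c)) \<le> ennreal (exp (l\<^sup>2 * d\<^sup>2 / 2))"
proof -
  interpret K: interval_bounded_random_variable "measure_pmf (K c)" "\<lambda>c'. U c' - U c - \<mu>" "- d" d
    by unfold_locales (auto intro!: AE_pmfI dest!: increment_le)
  have "l\<^sup>2 * (d - - d)\<^sup>2 / 8 = l\<^sup>2 * d\<^sup>2 / 2" by (simp add: power2_eq_square)
  then show ?thesis using K.Hoeffdings_lemma_nn_integral_0[OF assms drift] by metis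
qed

lemma endpoint_tail:
  assumes "0 < e"
  shows "measure M {\<omega> \<in> space M. real n * e \<le> U (X n \<omega>) - U (X 0 \<omega>) - real n * \<mu>}
      \<le> exp (- (e\<^sup>2 / (2 * (d + 1)\<^sup>2))) ^ n"
proof -
  obtain r where r: "\<And>n. distr M (count_space UNIV) (\<lambda>\<omega>. (X 0 \<omega>, X n \<omega>)) = measure_pmf (r n)"
    and r0: "set_pmf (r 0) \<subseteq> Id"
    and r_Suc: "\<And>n. r (Suc n) = bind_pmf (r n) (\<lambda>(a, b). map_pmf (Pair a) (K b))"
    using markov_chain_endpoints[OF mc] by blast
  \<comment> \<open>The minimiser of \<open>l\<^sup>2 * d\<^sup>2 / 2 - l * e\<close> is
    \<open>e / d\<^sup>2\<close>; replacing \<open>d\<close> by \<open>d + 1\<close> also covers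
    \<open>d = 0\<close> and still leaves an exponential rate.\<close>
  define l where "l = e / (d + 1)\<^sup>2"
  have l: "0 < l" using assms d_nonneg by (simp add: l_def)
  define V where "V n = (\<lambda>(a, b). U b - U a - real n * \<mu>)" for n
  have moment: "(\<integral>\<^sup>+x. ennreal (exp (l * V n x)) \<partial>measure_pmf (r n)) \<le> ennreal (exp (l\<^sup>2 * d\<^sup>2 / 2)) ^ n" for n
  proof (induction n)
    case 0
    have "(\<integral>\<^sup>+x. ennreal (exp (l * V 0 x)) \<partial>measure_pmf (r 0)) = (\<integral>\<^sup>+x. 1 \<partial>measure_pmf (r 0))"
      using r0 by (intro nn_integral_cong_AE AE_pmfI) (auto simp: V_def)
    then show ?case by simp
  next
    case (Suc n)
    have V: "exp (l * V (Suc n) (a, c)) = exp (l * V n (a, b)) * exp (l * (U c - U b - \<mu>))" for a b c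
      by (simp add: V_def flip: exp_add) (simp add: algebra_simps)
    have "(\<integral>\<^sup>+x. ennreal (exp (l * V (Suc n) x)) \<partial>measure_pmf (r (Suc n)))
        = (\<integral>\<^sup>+x. (\<integral>\<^sup>+c. ennreal (exp (l * V (Suc n) (fst x, c))) \<partial>measure_pmf (K (snd x))) \<partial>measure_pmf (r n))"
      by (simp add: r_Suc split_beta)
    also have "\<dots> = (\<integral>\<^sup>+x. ennreal (exp (l * V n x)) *
        (\<integral>\<^sup>+c. ennreal (exp (l * (U c - U (snd x) - \<mu>))) \<partial>measure_pmf (K (snd x))) \<partial>measure_pmf (r n))"
    proof (rule nn_integral_cong)
      fix x
      show "(\<integral>\<^sup>+c. ennreal (exp (l * V (Suc n) (fst x, c))) \<partial>measure_pmf (K (snd x)))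
        = ennreal (exp (l * V n x)) * (\<integral>\<^sup>+c. ennreal (exp (l * (U c - U (snd x) - \<mu>))) \<partial>measure_pmf (K (snd x)))"
        by (simp add: V[of "fst x" _ "snd x"] ennreal_mult' nn_integral_cmult)
    qed
    also have "\<dots> \<le> (\<integral>\<^sup>+x. ennreal (exp (l * V n x)) * ennreal (exp (l\<^sup>2 * d\<^sup>2 / 2)) \<partial>measure_pmf (r n))"
      by (intro nn_integral_mono mult_left_mono exp_moment_step l) auto
    also have "\<dots> \<le> ennreal (exp (l\<^sup>2 * d\<^sup>2 / 2)) ^ n * ennreal (exp (l\<^sup>2 * d\<^sup>2 / 2))"
      by (subst nn_integral_multc) (auto intro!: mult_right_mono Suc.IH)
    finally show ?case by (simp add: mult.commute)
  qed
  have "measure M {\<omega> \<in> space M. real n * e \<le> U (X n \<omega>) - U (X 0 \<omega>) - real n * \<mu>}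
      = measure (distr M (count_space UNIV) (\<lambda>\<omega>. (X 0 \<omega>, X n \<omega>))) {x. real n * e \<le> V n x}"
    by (subst measure_distr) (auto simp: V_def intro!: arg_cong[where f = "measure M"])
  also have "\<dots> = measure (measure_pmf (r n)) {x. real n * e \<le> V n x}" by (simp add: r)
  also have "ennreal \<dots> = (\<integral>\<^sup>+x. indicator {x. real n * e \<le> V n x} x \<partial>measure_pmf (r n))"
    by (simp add: measure_pmf.emeasure_eq_measure)
  also have "\<dots> \<le> (\<integral>\<^sup>+x. ennreal (exp (l * V n x)) * ennreal (exp (- (l * (real n * e)))) \<partial>measure_pmf (r n))"
  proof (rule nn_integral_mono)
    fix x
    have "1 \<le> exp (l * V n x) * exp (- (l * (real n * e)))" if "real n * e \<le> V n x"
      using mult_left_mono[OF that, of l] l by (simp flip: exp_add)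
    then show "indicator {x. real n * e \<le> V n x} x \<le> ennreal (exp (l * V n x)) * ennreal (exp (- (l * (real n * e))))"
      by (auto split: split_indicator simp flip: ennreal_mult ennreal_1 intro!: ennreal_leI)
  qed
  also have "\<dots> \<le> ennreal (exp (l\<^sup>2 * d\<^sup>2 / 2)) ^ n * ennreal (exp (- (l * (real n * e))))"
    by (subst nn_integral_multc) (auto intro!: mult_right_mono moment)
  also have "\<dots> = ennreal (exp (real n * (l\<^sup>2 * d\<^sup>2 / 2 - l * e)))"
    by (simp add: ennreal_power flip: ennreal_mult exp_of_nat_mult exp_add) (simp add: algebra_simps)
  also have "\<dots> \<le> ennreal (exp (real n * (- (e\<^sup>2 / (2 * (d + 1)\<^sup>2)))))"
  proof (intro ennreal_leI, subst exp_le_cancel_iff, rule mult_left_mono)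
    have "l\<^sup>2 * d\<^sup>2 \<le> l\<^sup>2 * (d + 1)\<^sup>2" using d_nonneg by (intro mult_left_mono power_mono) auto
    also have "\<dots> = l * e" using d_nonneg by (simp add: l_def power2_eq_square)
    finally have "l\<^sup>2 * d\<^sup>2 \<le> l * e" .
    moreover have "e\<^sup>2 / (2 * (d + 1)\<^sup>2) = l * e / 2"
      by (simp add: l_def power2_eq_square)
    ultimately show "l\<^sup>2 * d\<^sup>2 / 2 - l * e \<le> - (e\<^sup>2 / (2 * (d + 1)\<^sup>2))"
      by linarith
  qed simp
  finally show ?thesis by (simp flip: exp_of_nat_mult)
qed

end

text \<open>Provides the lower tail from the upper one.\<close>

lemma additive_functional_uminus:
  "additive_functional M K X U \<mu> d \<Longrightarrow> additive_functional M K X (\<lambda>c. - U c) (- \<mu>) d"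
proof -
  assume "additive_functional M K X U \<mu> d"
  then interpret additive_functional M K X U \<mu> d .
  show ?thesis
  proof
    fix c
    show "\<bar>- U c' - - U c - - \<mu>\<bar> \<le> d" if "c' \<in> set_pmf (K c)" for c'
      using increment_le[OF that] by linarith
    have "measure_pmf.expectation (K c) (\<lambda>c'. - U c' - - U c - - \<mu>) = measure_pmf.expectation (K c) (\<lambda>c'. - (U c' - U c - \<mu>))"
      by (simp add: algebra_simps)
    also have "\<dots> = 0" by (subst integral_minus) (simp add: drift)
    finally show "measure_pmf.expectation (K c) (\<lambda>c'. - U c' - - U c - - \<mu>) = 0" .
  qed (rule mc)
qed

context additive_functional
begin

lemma strong_law: "AE \<omega> in M. (\<lambda>n. (U (X n \<omega>) - U (X 0 \<omega>)) / real n) \<longlonglongrightarrow> \<mu>"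
proof -
  define D where "D n \<omega> = U (X n \<omega>) - U (X 0 \<omega>) - real n * \<mu>" for n \<omega>
  have [measurable]: "D n \<in> borel_measurable M" for n
    unfolding D_def by measurable
  interpret neg: additive_functional M K X "\<lambda>c. - U c" "- \<mu>" d
    by (rule additive_functional_uminus) unfold_locales
  have ev: "AE \<omega> in M. eventually (\<lambda>n. \<bar>D n \<omega>\<bar> < real n * e) sequentially" if "0 < e" for e
  proof -
    define A where "A n = {\<omega> \<in> space M. real n * e \<le> \<bar>D n \<omega>\<bar>}" for n
    define q where "q = exp (- (e\<^sup>2 / (2 * (d + 1)\<^sup>2)))"
    have A: "A n \<in> sets M" for n unfolding A_def by measurable
    have le: "measure M (A n) \<le> 2 * q ^ n" for n
    proof -
      have "A n = {\<omega> \<in> space M. real n * e \<le> U (X n \<omega>) - U (X 0 \<omega>) - real n * \<mu>} \<union>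
        {\<omega> \<in> space M. real n * e \<le> - U (X n \<omega>) - - U (X 0 \<omega>) - real n * - \<mu>}"
        by (auto simp: A_def D_def)
      also have "measure M \<dots> \<le> q ^ n + q ^ n"
        using endpoint_tail[OF that, of n] neg.endpoint_tail[OF that, of n] unfolding q_def
        by (intro order_trans[OF measure_Un_le] add_mono) auto
      finally show ?thesis by simp
    qed
    have "summable (\<lambda>n. 2 * q ^ n)"
    proof -
      have "\<bar>q\<bar> < 1" using that d_nonneg by (simp add: q_def)
      then show ?thesis by (intro summable_mult summable_geometric) simp
    qed
    then have "summable (\<lambda>n. measure M (A n))"
      by (rule summable_comparison_test'[where N = 0]) (simp add: le)
    then have "AE \<omega> in M. eventually (\<lambda>n. \<omega> \<in> space M - A n) sequentially"
      by (intro borel_cantelli_AE1 A) (auto simp: emeasure_eq_measure)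
    then show ?thesis
      by eventually_elim (auto simp: A_def elim!: eventually_mono)
  qed
  \<comment> \<open>Borel--Cantelli gives one null set for each tolerance; restricting to the
    tolerances \<open>1 / (k + 1)\<close> keeps their union null.\<close>
  have "AE \<omega> in M. \<forall>k. eventually (\<lambda>n. \<bar>D n \<omega>\<bar> < real n * inverse (real (Suc k))) sequentially"
    by (subst AE_all_countable) (auto intro: ev)
  then show ?thesis
  proof eventually_elim
    case (elim \<omega>)
    show ?case
    proof (rule LIMSEQ_I)
      fix e :: real assume "0 < e"
      then obtain k where k: "inverse (real (Suc k)) < e" using reals_Archimedean by blast
      from elim have "eventually (\<lambda>n. \<bar>D n \<omega>\<bar> < real n * inverse (real (Suc k))) sequentially" by blast
      then obtain m where m: "\<And>n. n \<ge> m \<Longrightarrow> \<bar>D n \<omega>\<bar> < real n * inverse (real (Suc k))"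
        by (auto simp: eventually_sequentially)
      show "\<exists>no. \<forall>n\<ge>no. norm ((U (X n \<omega>) - U (X 0 \<omega>)) / real n - \<mu>) < e"
      proof (intro exI allI impI)
        fix n assume n: "n \<ge> max m 1"
        then have "n \<ge> m" "0 < real n" by auto
        have "(U (X n \<omega>) - U (X 0 \<omega>)) / real n - \<mu> = D n \<omega> / real n"
          using \<open>0 < real n\<close> by (simp add: D_def field_simps)
        moreover have "\<bar>D n \<omega>\<bar> / real n < inverse (real (Suc k))"
          using m[OF \<open>n \<ge> m\<close>] \<open>0 < real n\<close> by (simp add: pos_divide_less_eq mult.commute)
        ultimately show "norm ((U (X n \<omega>) - U (X 0 \<omega>)) / real n - \<mu>) < e"
          using k \<open>0 < real n\<close> by (simp add: abs_divide)
      qed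
    qed
  qed
qed

end

section \<open>The central limit theorem\<close>

context additive_functional
begin

text \<open>Expand to second order in \<open>s\<close>. The linear term vanishes by
  \<open>drift\<close>, and the quadratic one averages to \<open>- s\<^sup>2 * (g c + v) / 2\<close>
  by \<open>variance\<close>, which to this order is the product of the new ratio and the old
  corrector. The three constants come from the Taylor remainder of the exponential, from the product
  of its first-order remainder with the corrector, and from the surplus
  \<open>s\<^sup>4 * v * g c / 4\<close> of the factorisation.\<close>

lemma char_recursion:
  assumes g: "\<And>c. \<bar>g c\<bar> \<le> B"
    and variance: "\<And>c. measure_pmf.expectation (K c) (\<lambda>c'. (U c' - U c - \<mu>)\<^sup>2 + g c') = g c + v"
    and s: "\<bar>s\<bar> \<le> 1"
  shows "norm (measure_pmf.expectation (K c) (\<lambda>c'. iexp (s * (U c' - U c - \<mu>)) * of_real (1 - s\<^sup>2 * g c' / 2))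
      - of_real ((1 - s\<^sup>2 * v / 2) * (1 - s\<^sup>2 * g c / 2))) \<le> (d ^ 3 / 6 + d * B / 2 + \<bar>v\<bar> * B / 4) * \<bar>s\<bar> ^ 3"
proof -
  have B: "0 \<le> B" using g[of undefined] by linarith
  define D where "D c' = U c' - U c - \<mu>" for c'
  have D: "\<bar>D c'\<bar> \<le> d" if "c' \<in> set_pmf (K c)" for c'
    using increment_le[OF that] by (simp add: D_def)
  define A where "A c' = iexp (s * D c') * of_real (1 - s\<^sup>2 * g c' / 2)" for c'
  \<comment> \<open>The expansion of \<open>A\<close> through order \<open>s\<^sup>2\<close>; the
    product of \<open>exp - 1\<close> with the corrector is already of order
    \<open>s\<^sup>3\<close> and goes into the error.\<close>
  define A2 where "A2 c' = 1 + s * D c' * \<i> - of_real (s\<^sup>2 / 2 * ((D c')\<^sup>2 + g c'))" for c'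
  have diff: "norm (A c' - A2 c') \<le> (d ^ 3 / 6 + d * B / 2) * \<bar>s\<bar> ^ 3" if "c' \<in> set_pmf (K c)" for c'
  proof -
    let ?x = "s * D c'"
    have x: "\<bar>?x\<bar> \<le> \<bar>s\<bar> * d" using D[OF that] by (simp add: abs_mult mult_left_mono)
    have "A c' - A2 c' = (iexp ?x - (\<Sum>k\<le>2. (\<i> * ?x) ^ k / fact k)) - (iexp ?x - (\<Sum>k\<le>0. (\<i> * ?x) ^ k / fact k)) * of_real (s\<^sup>2 * g c' / 2)"
      by (simp add: A_def A2_def numeral_2_eq_2) (simp add: power2_eq_square field_simps)
    also have "norm \<dots> \<le> \<bar>?x\<bar> ^ 3 / 6 + \<bar>?x\<bar> * (s\<^sup>2 * B / 2)"
    proof (rule order_trans[OF norm_triangle_ineq4], rule add_mono)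
      show "norm (iexp ?x - (\<Sum>k\<le>2. (\<i> * ?x) ^ k / fact k)) \<le> \<bar>?x\<bar> ^ 3 / 6"
        using iexp_approx1[of ?x 2] by (simp add: eval_nat_numeral)
      show "norm ((iexp ?x - (\<Sum>k\<le>0. (\<i> * ?x) ^ k / fact k)) * of_real (s\<^sup>2 * g c' / 2)) \<le> \<bar>?x\<bar> * (s\<^sup>2 * B / 2)"
        unfolding norm_mult
      proof (rule mult_mono)
        show "norm (iexp ?x - (\<Sum>k\<le>0. (\<i> * ?x) ^ k / fact k)) \<le> \<bar>?x\<bar>"
          using iexp_approx1[of ?x 0] by simp
        show "norm (of_real (s\<^sup>2 * g c' / 2) :: complex) \<le> s\<^sup>2 * B / 2"
          unfolding norm_of_real using g[of c'] by (simp add: abs_mult mult_left_mono)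
      qed auto
    qed
    also have "\<dots> \<le> (\<bar>s\<bar> * d) ^ 3 / 6 + (\<bar>s\<bar> * d) * (s\<^sup>2 * B / 2)"
      using x B by (intro add_mono divide_right_mono power_mono mult_right_mono) auto
    also have "\<dots> = (d ^ 3 / 6 + d * B / 2) * \<bar>s\<bar> ^ 3"
      by (simp add: power_mult_distrib algebra_simps power3_eq_cube power2_eq_square flip: power2_abs)
    finally show ?thesis .
  qed
  have int_A: "integrable (measure_pmf (K c)) A"
  proof (rule measure_pmf.integrable_const_bound[where B = "1 + s\<^sup>2 * B / 2"])
    have "norm (1 - s\<^sup>2 * g c' / 2) \<le> 1 + s\<^sup>2 * B / 2" for c'
    proof -
      have "\<bar>s\<^sup>2 * g c'\<bar> \<le> s\<^sup>2 * B" using g[of c'] by (simp add: abs_mult mult_left_mono)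
      then show ?thesis unfolding real_norm_def by linarith
    qed
    then show "AE c' in measure_pmf (K c). norm (A c') \<le> 1 + s\<^sup>2 * B / 2"
      by (simp add: A_def norm_mult norm_of_real del: of_real_diff of_real_1)
  qed simp
  have int_D: "integrable (measure_pmf (K c)) D"
    by (rule measure_pmf.integrable_const_bound[where B = d]) (auto intro!: AE_pmfI D)
  have int_D2: "integrable (measure_pmf (K c)) (\<lambda>c'. (D c')\<^sup>2 + g c')"
  proof (rule measure_pmf.integrable_const_bound[where B = "d\<^sup>2 + B"], rule AE_pmfI)
    fix c' assume "c' \<in> set_pmf (K c)"
    from power_mono[OF D[OF this], of 2] have "(D c')\<^sup>2 \<le> d\<^sup>2" by simp
    then show "norm ((D c')\<^sup>2 + g c') \<le> d\<^sup>2 + B"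
      using g[of c'] by (simp add: abs_le_iff) (smt (verit) zero_le_power2)
  qed simp
  have int_1: "integrable (measure_pmf (K c)) (\<lambda>c'. complex_of_real (s * D c') * \<i>)"
    by (intro integrable_mult_left integrable_of_real integrable_mult_right int_D)
  have int_2: "integrable (measure_pmf (K c)) (\<lambda>c'. complex_of_real (s\<^sup>2 / 2 * ((D c')\<^sup>2 + g c')))"
    by (intro integrable_of_real integrable_mult_right int_D2)
  have int_A2: "integrable (measure_pmf (K c)) A2"
    unfolding A2_def by (intro Bochner_Integration.integrable_add Bochner_Integration.integrable_diff int_1 int_2) simp
  have E_A2: "measure_pmf.expectation (K c) A2 = of_real (1 - s\<^sup>2 / 2 * (g c + v))"
  proof -
    have "measure_pmf.expectation (K c) A2
        = 1 + s * measure_pmf.expectation (K c) D * \<i> - of_real (s\<^sup>2 / 2 * measure_pmf.expectation (K c) (\<lambda>c'. (D c')\<^sup>2 + g c'))"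
      unfolding A2_def
      by (subst Bochner_Integration.integral_diff[OF Bochner_Integration.integrable_add[OF _ int_1] int_2], simp,
          subst Bochner_Integration.integral_add[OF _ int_1], simp)
        (simp only: integral_mult_left_zero integral_complex_of_real integral_mult_right_zero, simp)
    also have "measure_pmf.expectation (K c) D = 0" using drift[of c] by (simp add: D_def[abs_def])
    also have "measure_pmf.expectation (K c) (\<lambda>c'. (D c')\<^sup>2 + g c') = g c + v" using variance[of c] by (simp add: D_def[abs_def])
    finally show ?thesis by simp
  qed
  have "norm (measure_pmf.expectation (K c) A - measure_pmf.expectation (K c) A2) \<le> (d ^ 3 / 6 + d * B / 2) * \<bar>s\<bar> ^ 3"
    unfolding Bochner_Integration.integral_diff[OF int_A int_A2, symmetric]
    by (intro order_trans[OF integral_norm_bound] measure_pmf.integral_le_const integrable_norm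
        Bochner_Integration.integrable_diff int_A int_A2 AE_pmfI diff)
  moreover have "norm (measure_pmf.expectation (K c) A2 - of_real ((1 - s\<^sup>2 * v / 2) * (1 - s\<^sup>2 * g c / 2))) \<le> \<bar>v\<bar> * B / 4 * \<bar>s\<bar> ^ 3"
  proof -
    have "measure_pmf.expectation (K c) A2 - of_real ((1 - s\<^sup>2 * v / 2) * (1 - s\<^sup>2 * g c / 2)) = of_real (- (s ^ 4 * v * g c / 4))"
      unfolding E_A2 of_real_diff[symmetric] by (rule arg_cong[where f = of_real]) (simp add: algebra_simps eval_nat_numeral)
    also have "norm \<dots> = \<bar>s\<bar> ^ 4 * (\<bar>v\<bar> * \<bar>g c\<bar> / 4)"
      unfolding norm_of_real by (simp add: abs_mult power_abs)
    also have "\<dots> \<le> \<bar>s\<bar> ^ 3 * (\<bar>v\<bar> * B / 4)"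
      using s g[of c] by (intro mult_mono power_decreasing divide_right_mono mult_left_mono) auto
    finally show ?thesis by (simp add: mult.commute)
  qed
  ultimately have "norm (measure_pmf.expectation (K c) A - of_real ((1 - s\<^sup>2 * v / 2) * (1 - s\<^sup>2 * g c / 2)))
      \<le> (d ^ 3 / 6 + d * B / 2) * \<bar>s\<bar> ^ 3 + \<bar>v\<bar> * B / 4 * \<bar>s\<bar> ^ 3"
    by (rule norm_diff_triangle_le)
  then show ?thesis by (simp add: A_def[abs_def] D_def algebra_simps)
qed

text \<open>The assumption \<open>s\<^sup>2 * v \<le> 4\<close> puts the ratio
  \<open>1 - s\<^sup>2 * v / 2\<close> in \<open>[- 1, 1]\<close>, so the errors of \<open>n\<close>
  steps merely add up. Inserting the corrector at time 0 and removing it at time \<open>n\<close>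
  costs \<open>s\<^sup>2 * B / 2\<close> each.\<close>

lemma char_bound:
  assumes g: "\<And>c. \<bar>g c\<bar> \<le> B"
    and variance: "\<And>c. measure_pmf.expectation (K c) (\<lambda>c'. (U c' - U c - \<mu>)\<^sup>2 + g c') = g c + v"
    and s: "\<bar>s\<bar> \<le> 1" and v: "0 \<le> v" "s\<^sup>2 * v \<le> 4"
  shows "norm (expectation (\<lambda>\<omega>. iexp (s * (U (X n \<omega>) - U (X 0 \<omega>) - real n * \<mu>))) - of_real ((1 - s\<^sup>2 * v / 2) ^ n))
      \<le> real n * ((d ^ 3 / 6 + d * B / 2 + \<bar>v\<bar> * B / 4) * \<bar>s\<bar> ^ 3) + s\<^sup>2 * B"
proof -
  obtain r where r: "\<And>n. distr M (count_space UNIV) (\<lambda>\<omega>. (X 0 \<omega>, X n \<omega>)) = measure_pmf (r n)"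
    and r0: "set_pmf (r 0) \<subseteq> Id"
    and r_Suc: "\<And>n. r (Suc n) = bind_pmf (r n) (\<lambda>(a, b). map_pmf (Pair a) (K b))"
    using markov_chain_endpoints[OF mc] by blast
  define \<epsilon> where "\<epsilon> = (d ^ 3 / 6 + d * B / 2 + \<bar>v\<bar> * B / 4) * \<bar>s\<bar> ^ 3"
  define a where "a = complex_of_real (1 - s\<^sup>2 * v / 2)"
  define V where "V n x = U (snd x) - U (fst x) - real n * \<mu>" for n and x :: "'s \<times> 's"
  define w where "w c = complex_of_real (1 - s\<^sup>2 * g c / 2)" for c
  define E where "E n = measure_pmf.expectation (r n) (\<lambda>x. iexp (s * V n x) * w (snd x))" for n
  have B: "0 \<le> B" using g[of undefined] by linarith
  have a: "norm a \<le> 1" using v unfolding a_def norm_of_real by (simp add: abs_le_iff)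
  have w1: "norm (w c - 1) \<le> s\<^sup>2 * B / 2" for c
  proof -
    have "w c - 1 = of_real (- (s\<^sup>2 * g c / 2))" by (simp add: w_def)
    then have "norm (w c - 1) = s\<^sup>2 * \<bar>g c\<bar> / 2" by (simp add: norm_mult norm_power)
    then show ?thesis using g[of c] by (simp add: mult_left_mono)
  qed
  have w: "norm (w c) \<le> 1 + s\<^sup>2 * B / 2" for c
    using norm_triangle_ineq[of "w c - 1" 1] w1[of c] by simp
  have int: "integrable (measure_pmf p) (\<lambda>x. iexp (s * V n x) * w (snd x))" for p n
    by (rule measure_pmf.integrable_const_bound[where B = "1 + s\<^sup>2 * B / 2"]) (auto simp: norm_mult w)
  have int': "integrable (measure_pmf p) (\<lambda>x. iexp (s * V n x))" for p n
    by (rule measure_pmf.integrable_const_bound[where B = 1]) auto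
  define F where "F b = measure_pmf.expectation (K b) (\<lambda>c. iexp (s * (U c - U b - \<mu>)) * w c)" for b
  have F: "norm (F b - a * w b) \<le> \<epsilon>" for b
    using char_recursion[OF g variance s, of b] by (simp add: F_def a_def w_def \<epsilon>_def)
  have F_le: "norm (F b) \<le> 1 + s\<^sup>2 * B / 2" for b
    unfolding F_def
    by (intro order_trans[OF integral_norm_bound] measure_pmf.integral_le_const integrable_norm
        measure_pmf.integrable_const_bound[where B = "1 + s\<^sup>2 * B / 2"]) (auto simp: norm_mult w)
  have E_Suc: "E (Suc n) = measure_pmf.expectation (r n) (\<lambda>x. iexp (s * V n x) * F (snd x))" for n
  proof -
    have V: "iexp (s * V (Suc n) (a, c)) = iexp (s * V n (a, b)) * iexp (s * (U c - U b - \<mu>))" for a b c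
      by (simp add: V_def flip: exp_add) (simp add: algebra_simps)
    have "E (Suc n) = measure_pmf.expectation (r n) (\<lambda>x. measure_pmf.expectation (K (snd x))
        (\<lambda>c. iexp (s * V (Suc n) (fst x, c)) * w c))"
      unfolding E_def r_Suc
      by (subst expectation_bind_pmf[where B = "1 + s\<^sup>2 * B / 2"]) (auto simp: norm_mult w split_beta)
    also have "\<dots> = measure_pmf.expectation (r n) (\<lambda>x. iexp (s * V n x) * F (snd x))"
    proof (rule Bochner_Integration.integral_cong[OF refl])
      fix x
      show "measure_pmf.expectation (K (snd x)) (\<lambda>c. iexp (s * V (Suc n) (fst x, c)) * w c) = iexp (s * V n x) * F (snd x)"
        unfolding V[of "fst x" _ "snd x"] prod.collapse mult.assoc F_def by (rule integral_mult_right_zero)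
    qed
    finally show ?thesis .
  qed
  have step: "norm (E (Suc n) - a * E n) \<le> \<epsilon>" for n
  proof -
    have intF: "integrable (measure_pmf (r n)) (\<lambda>x. iexp (s * V n x) * F (snd x))"
      by (rule measure_pmf.integrable_const_bound[where B = "1 + s\<^sup>2 * B / 2"]) (auto simp: norm_mult F_le)
    have "E (Suc n) - a * E n = measure_pmf.expectation (r n) (\<lambda>x. iexp (s * V n x) * F (snd x) - a * (iexp (s * V n x) * w (snd x)))"
      unfolding E_Suc unfolding E_def 
      by (subst Bochner_Integration.integral_diff[OF intF integrable_mult_right[OF int]], subst integral_mult_right_zero) (rule refl)
    also have "norm \<dots> \<le> \<epsilon>"
    proof (intro order_trans[OF integral_norm_bound] measure_pmf.integral_le_const integrable_norm
        Bochner_Integration.integrable_diff integrable_mult_right intF int AE_pmfI)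
      fix x
      have "iexp (s * V n x) * F (snd x) - a * (iexp (s * V n x) * w (snd x)) = iexp (s * V n x) * (F (snd x) - a * w (snd x))"
        by (simp add: algebra_simps)
      then show "norm (iexp (s * V n x) * F (snd x) - a * (iexp (s * V n x) * w (snd x))) \<le> \<epsilon>"
        using F by (simp add: norm_mult)
    qed
    finally show ?thesis .
  qed
  have "norm (E n - a ^ n * E 0) \<le> real n * \<epsilon>" for n
  proof (induction n)
    case (Suc n)
    have "E (Suc n) - a ^ Suc n * E 0 = (E (Suc n) - a * E n) + a * (E n - a ^ n * E 0)"
      by (simp add: algebra_simps)
    also have "norm \<dots> \<le> \<epsilon> + norm a * norm (E n - a ^ n * E 0)"
      by (intro order_trans[OF norm_triangle_ineq] add_mono step) (simp add: norm_mult)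
    also have "\<dots> \<le> \<epsilon> + 1 * (real n * \<epsilon>)"
      by (intro add_mono mult_mono Suc.IH a) auto
    finally show ?case by (simp add: algebra_simps)
  qed simp
  moreover have "norm (a ^ n * E 0 - a ^ n) \<le> s\<^sup>2 * B / 2"
  proof -
    have "E 0 = measure_pmf.expectation (r 0) (\<lambda>x. w (snd x))"
      unfolding E_def using r0 by (intro integral_cong_AE AE_pmfI) (auto simp: V_def)
    also have "\<dots> - 1 = measure_pmf.expectation (r 0) (\<lambda>x. w (snd x) - 1)"
      by (subst Bochner_Integration.integral_diff) (auto intro!: measure_pmf.integrable_const_bound[where B = "1 + s\<^sup>2 * B / 2"] simp: w)
    finally have E0: "E 0 - 1 = measure_pmf.expectation (r 0) (\<lambda>x. w (snd x) - 1)" .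
    have "norm (E 0 - 1) \<le> s\<^sup>2 * B / 2"
      unfolding E0
      by (intro order_trans[OF integral_norm_bound] measure_pmf.integral_le_const integrable_norm
          Bochner_Integration.integrable_diff measure_pmf.integrable_const_bound[where B = "1 + s\<^sup>2 * B / 2"] AE_pmfI w w1)
        (auto simp: B)
    moreover have "a ^ n * E 0 - a ^ n = a ^ n * (E 0 - 1)" by (simp add: algebra_simps)
    moreover have "norm (a ^ n) \<le> 1" using a by (simp add: norm_power power_le_one)
    ultimately show ?thesis
      using mult_mono[of "norm (a ^ n)" 1 "norm (E 0 - 1)" "s\<^sup>2 * B / 2"] by (simp add: norm_mult)
  qed
  moreover have "norm (measure_pmf.expectation (r n) (\<lambda>x. iexp (s * V n x)) - E n) \<le> s\<^sup>2 * B / 2"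
  proof -
    have "measure_pmf.expectation (r n) (\<lambda>x. iexp (s * V n x)) - E n
       = measure_pmf.expectation (r n) (\<lambda>x. iexp (s * V n x) - iexp (s * V n x) * w (snd x))"
      unfolding E_def by (rule Bochner_Integration.integral_diff[symmetric, OF int' int])
    also have "norm \<dots> \<le> s\<^sup>2 * B / 2"
    proof (intro order_trans[OF integral_norm_bound] measure_pmf.integral_le_const integrable_norm
        Bochner_Integration.integrable_diff int int' AE_pmfI)
      fix x
      have "iexp (s * V n x) - iexp (s * V n x) * w (snd x) = iexp (s * V n x) * (1 - w (snd x))"
        by (simp add: algebra_simps)
      then show "norm (iexp (s * V n x) - iexp (s * V n x) * w (snd x)) \<le> s\<^sup>2 * B / 2"
        using w1[of "snd x"] by (simp add: norm_mult norm_minus_commute)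
    qed
    finally show ?thesis .
  qed
  ultimately have "norm (measure_pmf.expectation (r n) (\<lambda>x. iexp (s * V n x)) - a ^ n)
      \<le> s\<^sup>2 * B / 2 + (real n * \<epsilon> + s\<^sup>2 * B / 2)"
    by (meson norm_diff_triangle_le)
  moreover have "measure_pmf.expectation (r n) (\<lambda>x. iexp (s * V n x))
      = expectation (\<lambda>\<omega>. iexp (s * (U (X n \<omega>) - U (X 0 \<omega>) - real n * \<mu>)))"
    unfolding r[symmetric] by (subst integral_distr) (auto simp: V_def)
  ultimately show ?thesis by (simp add: a_def \<epsilon>_def mult.commute)
qed

text \<open>\<open>T\<close> is the observed quantity and \<open>U\<close> its martingale version.
  They stay within \<open>H\<close> of each other, so their characteristic functions at
  \<open>s n\<close> differ by at most \<open>2 * H * \<bar>s n\<bar>\<close>, which vanishes in the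
  limit.\<close>

lemma central_limit:
  assumes g: "\<And>c. \<bar>g c\<bar> \<le> B"
    and variance: "\<And>c. measure_pmf.expectation (K c) (\<lambda>c'. (U c' - U c - \<mu>)\<^sup>2 + g c') = g c + v"
    and v: "0 < v"
    and close: "\<And>c. \<bar>T c - U c\<bar> \<le> H"
  shows "weak_conv_m (\<lambda>n. distr M borel (\<lambda>\<omega>. (T (X n \<omega>) - T (X 0 \<omega>) - real n * \<mu>) / sqrt (real n * v))) std_normal_distribution"
proof (rule levy_continuity)
  show "real_distribution (distr M borel (\<lambda>\<omega>. (T (X n \<omega>) - T (X 0 \<omega>) - real n * \<mu>) / sqrt (real n * v)))" for n
    by (rule real_distribution_distr) measurable
  show "real_distribution std_normal_distribution" by (rule real_dist_normal_dist)
  fix t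
  define C where "C = d ^ 3 / 6 + d * B / 2 + \<bar>v\<bar> * B / 4"
  define s where "s n = t / sqrt (real n * v)" for n
  have s0: "s \<longlonglongrightarrow> 0"
    unfolding s_def using v by real_asymp
  define \<phi> where "\<phi> n = char (distr M borel (\<lambda>\<omega>. (T (X n \<omega>) - T (X 0 \<omega>) - real n * \<mu>) / sqrt (real n * v))) t" for n
  have \<phi>: "\<phi> n = expectation (\<lambda>\<omega>. iexp (s n * (T (X n \<omega>) - T (X 0 \<omega>) - real n * \<mu>)))" for n
    unfolding \<phi>_def char_def by (subst integral_distr) (auto simp: s_def)
  have TU: "norm (\<phi> n - expectation (\<lambda>\<omega>. iexp (s n * (U (X n \<omega>) - U (X 0 \<omega>) - real n * \<mu>)))) \<le> \<bar>s n\<bar> * (2 * H)" for n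
  proof -
    have int: "integrable M (\<lambda>\<omega>. iexp (s n * (W (X n \<omega>) - W (X 0 \<omega>) - real n * \<mu>)))" for W
      by (rule integrable_const_bound[where B = 1]) auto
    show ?thesis
      unfolding \<phi> Bochner_Integration.integral_diff[OF int int, symmetric]
    proof (intro order_trans[OF integral_norm_bound] integral_le_const integrable_norm
        Bochner_Integration.integrable_diff int AE_I2)
      fix \<omega>
      let ?x = "s n * (T (X n \<omega>) - T (X 0 \<omega>) - real n * \<mu>)" and ?y = "s n * (U (X n \<omega>) - U (X 0 \<omega>) - real n * \<mu>)"
      have "iexp ?x - iexp ?y = iexp ?y * (iexp (?x - ?y) - 1)"
        by (simp add: algebra_simps flip: exp_add)
      then have "norm (iexp ?x - iexp ?y) \<le> \<bar>?x - ?y\<bar>"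
        using iexp_approx1[of "?x - ?y" 0] by (simp add: norm_mult)
      also have "\<bar>?x - ?y\<bar> = \<bar>s n\<bar> * \<bar>(T (X n \<omega>) - U (X n \<omega>)) - (T (X 0 \<omega>) - U (X 0 \<omega>))\<bar>"
        by (simp flip: abs_mult) (simp add: algebra_simps)
      also have "\<dots> \<le> \<bar>s n\<bar> * (2 * H)"
        using close[of "X n \<omega>"] close[of "X 0 \<omega>"] by (intro mult_left_mono) linarith+
      finally show "norm (iexp ?x - iexp ?y) \<le> \<bar>s n\<bar> * (2 * H)" .
    qed
  qed
  have "eventually (\<lambda>n. norm (\<phi> n - of_real ((1 + (- t\<^sup>2 / 2) / real n) ^ n))
      \<le> \<bar>s n\<bar> * (2 * H) + (real n * (C * \<bar>s n\<bar> ^ 3) + (s n)\<^sup>2 * B)) sequentially"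
  proof -
    have "eventually (\<lambda>n. \<bar>s n\<bar> < min 1 (2 / sqrt v)) sequentially"
      using s0 v by (intro order_tendstoD(2)[OF tendsto_rabs_zero]) auto
    then show ?thesis using eventually_gt_at_top[of 0]
    proof eventually_elim
      case (elim n)
      have "(s n)\<^sup>2 \<le> (2 / sqrt v)\<^sup>2"
        using elim v by (subst abs_le_square_iff[symmetric]) auto
      then have "(s n)\<^sup>2 * v \<le> 4" using v by (simp add: power_divide field_simps)
      from char_bound[OF g variance _ _ this, of n] elim v
      have "norm (expectation (\<lambda>\<omega>. iexp (s n * (U (X n \<omega>) - U (X 0 \<omega>) - real n * \<mu>))) - of_real ((1 - (s n)\<^sup>2 * v / 2) ^ n))
          \<le> real n * (C * \<bar>s n\<bar> ^ 3) + (s n)\<^sup>2 * B" by (simp add: C_def)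
      moreover have "1 - (s n)\<^sup>2 * v / 2 = 1 + (- t\<^sup>2 / 2) / real n"
        using v elim by (simp add: s_def power_divide field_simps)
      ultimately show ?case by (intro norm_diff_triangle_le[OF TU[of n]]) simp
    qed
  qed
  moreover have "(\<lambda>n. \<bar>s n\<bar> * (2 * H) + (real n * (C * \<bar>s n\<bar> ^ 3) + (s n)\<^sup>2 * B)) \<longlonglongrightarrow> 0"
  proof -
    \<comment> \<open>The accumulated error is of order \<open>n * \<bar>s n\<bar> ^ 3\<close>; as
      \<open>n * (s n)\<^sup>2\<close> is the constant \<open>t\<^sup>2 / v\<close>, one factor
      \<open>s n\<close> is left over and tends to 0.\<close>
    have "eventually (\<lambda>n. real n * (C * \<bar>s n\<bar> ^ 3) = C * (t\<^sup>2 / v) * \<bar>s n\<bar>) sequentially"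
      using eventually_gt_at_top[of 0]
    proof eventually_elim
      case (elim n)
      have "real n * (s n)\<^sup>2 = t\<^sup>2 / v" using v elim by (simp add: s_def power_divide)
      moreover have "\<bar>s n\<bar> ^ 3 = (s n)\<^sup>2 * \<bar>s n\<bar>" by (simp add: power3_eq_cube power2_eq_square flip: power2_abs)
      ultimately show ?case by (metis (no_types, lifting) mult.assoc mult.left_commute)
    qed
    moreover have "(\<lambda>n. C * (t\<^sup>2 / v) * \<bar>s n\<bar>) \<longlonglongrightarrow> 0"
      by (intro tendsto_mult_right_zero tendsto_rabs_zero s0)
    ultimately have "(\<lambda>n. real n * (C * \<bar>s n\<bar> ^ 3)) \<longlonglongrightarrow> 0"
      by (simp add: tendsto_cong)
    then show ?thesis
      by (auto intro!: tendsto_add_zero tendsto_mult_left_zero tendsto_rabs_zero tendsto_null_power s0)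
  qed
  ultimately have "(\<lambda>n. \<phi> n - of_real ((1 + (- t\<^sup>2 / 2) / real n) ^ n)) \<longlonglongrightarrow> 0"
    by (rule Lim_null_comparison)
  moreover have "(\<lambda>n. complex_of_real ((1 + (- t\<^sup>2 / 2) / real n) ^ n)) \<longlonglongrightarrow> of_real (exp (- t\<^sup>2 / 2))"
    by (intro tendsto_of_real tendsto_exp_limit_sequentially)
  ultimately have "\<phi> \<longlonglongrightarrow> of_real (exp (- t\<^sup>2 / 2))"
    using tendsto_add by fastforce
  then show "(\<lambda>n. char (distr M borel (\<lambda>\<omega>. (T (X n \<omega>) - T (X 0 \<omega>) - real n * \<mu>) / sqrt (real n * v))) t)
      \<longlonglongrightarrow> char std_normal_distribution t"
    by (simp add: \<phi>_def[abs_def] char_std_normal_distribution)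
qed

end

section \<open>One step of the mixed game\<close>

definition residues :: "('n \<Rightarrow> int) \<Rightarrow> ('n \<Rightarrow> 3)" where
  "residues c = (\<lambda>i. of_int (c i))"

text \<open>The test function \<open>F\<close> receives the profit of the play together with the new
  residues. Expectations under the games on capitals and payoff-weighted row sums of the transition
  matrix both reduce to this form (\<open>expectation_mixed_game\<close>,
  \<open>sum_P_mixed\<close>), which ties the dynamics to the matrix definition of the
  variance.\<close>

definition step_B :: "real \<Rightarrow> (int \<Rightarrow> ('n::finite \<Rightarrow> 3) \<Rightarrow> real) \<Rightarrow> ('n \<Rightarrow> 3) \<Rightarrow> real" where
  "step_B \<rho> F x = (\<Sum>i\<in>UNIV. win_prob \<rho> (x i) * F 1 (x(i := x i + 1)) + lose_prob \<rho> (x i) * F (- 1) (x(i := x i - 1)))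
     / real CARD('n)"

definition step_A' :: "(int \<Rightarrow> ('n::finite \<Rightarrow> 3) \<Rightarrow> real) \<Rightarrow> ('n \<Rightarrow> 3) \<Rightarrow> real" where
  "step_A' F x = (\<Sum>i\<in>UNIV. \<Sum>j\<in>UNIV - {i}. F 0 (x(i := x i - 1, j := x j + 1)))
     / (real CARD('n) * (real CARD('n) - 1))"

definition step :: "real \<Rightarrow> real \<Rightarrow> (int \<Rightarrow> ('n::finite \<Rightarrow> 3) \<Rightarrow> real) \<Rightarrow> ('n \<Rightarrow> 3) \<Rightarrow> real" where
  "step \<rho> \<gamma> F x = \<gamma> * step_A' F x + (1 - \<gamma>) * step_B \<rho> F x"

lemma win_prob_bounds: "0 < \<rho> \<Longrightarrow> 0 < win_prob \<rho> j \<and> win_prob \<rho> j < 1"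
  by (simp add: win_prob_def add_pos_pos add_pos_nonneg)

lemma residues_upd [simp]: "residues (c(i := a)) = (residues c)(i := of_int a)"
  by (auto simp: residues_def)

lemma card_pairs: "card {(i::'n::finite, j). i \<noteq> j} = CARD('n) * (CARD('n) - 1)"
proof -
  have "{(i::'n, j). i \<noteq> j} = Sigma UNIV (\<lambda>i. UNIV - {i})" by auto
  then show ?thesis by (simp add: card_Diff_singleton)
qed

lemma sum_pairs:
  fixes f :: "'n::finite \<Rightarrow> 'n \<Rightarrow> real"
  shows "(\<Sum>(i, j)\<in>{(i, j). i \<noteq> j}. f i j) = (\<Sum>i\<in>UNIV. \<Sum>j\<in>UNIV - {i}. f i j)"
proof -
  have "{(i::'n, j). i \<noteq> j} = Sigma UNIV (\<lambda>i. UNIV - {i})" by auto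
  then show ?thesis by (simp add: sum.Sigma)
qed

definition capital :: "('n::finite \<Rightarrow> int) \<Rightarrow> int" where
  "capital c = (\<Sum>i\<in>UNIV. c i)"

lemma capital_upd [simp]: "capital (c(i := a)) = capital c - c i + a"
proof -
  have "capital (c(i := a)) = a + (\<Sum>k\<in>UNIV - {i}. c k)"
    unfolding capital_def by (subst sum.remove[of _ i]) (auto intro!: sum.cong)
  moreover have "capital c = c i + (\<Sum>k\<in>UNIV - {i}. c k)"
    unfolding capital_def by (subst sum.remove[of _ i]) auto
  ultimately show ?thesis by simp
qed

text \<open>Game \<open>A'\<close> samples from this set, and \<open>pmf_of_set\<close> has its
  meaning only on nonempty sets.\<close>

lemma pairs_nonempty:
  assumes "CARD('n::finite) \<ge> 2"
  shows "{(i::'n, j). i \<noteq> j} \<noteq> {}"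
proof -
  obtain i j :: 'n where "i \<noteq> j"
    using assms by (metis (full_types) card_le_Suc0_iff_eq UNIV_I finite not_less_eq_eq numeral_2_eq_2)
  then show ?thesis by auto
qed

lemma capital_game_A':
  fixes c :: "'n::finite \<Rightarrow> int"
  assumes "CARD('n) \<ge> 2" and "c' \<in> set_pmf (game_A' c)"
  shows "capital c' = capital c"
  using assms(2) pairs_nonempty[OF assms(1)] by (auto simp: game_A'_def set_pmf_of_set)

lemma capital_game_B:
  assumes "c' \<in> set_pmf (game_B \<rho> c)"
  shows "\<bar>capital c' - capital c\<bar> \<le> 1"
  using assms by (auto simp: game_B_def)

lemma capital_mixed_game:
  fixes c :: "'n::finite \<Rightarrow> int"
  assumes "CARD('n) \<ge> 2" and "c' \<in> set_pmf (mixed_game \<rho> \<gamma> c)"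
  shows "\<bar>capital c' - capital c\<bar> \<le> 1"
proof -
  from assms(2) obtain b where "c' \<in> set_pmf (if b then game_A' c else game_B \<rho> c)"
    by (auto simp: mixed_game_def simp del: if_split)
  then show ?thesis
    using capital_game_A'[OF assms(1), of c' c] capital_game_B[of c' \<rho> c] by (cases b) auto
qed

lemma expectation_mixed_game:
  fixes c :: "'n::finite \<Rightarrow> int"
  assumes N: "CARD('n) \<ge> 2" and \<rho>: "0 < \<rho>" and \<gamma>: "0 \<le> \<gamma>" "\<gamma> \<le> 1"
  shows "measure_pmf.expectation (mixed_game \<rho> \<gamma> c) (\<lambda>c'. F (capital c' - capital c) (residues c'))
    = step \<rho> \<gamma> F (residues c)" (is "measure_pmf.expectation _ ?f = _")
proof -
  note ne = pairs_nonempty[OF N]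
  have A: "measure_pmf.expectation (game_A' c) ?f = step_A' F (residues c)"
  proof -
    have "measure_pmf.expectation (game_A' c) ?f
       = (\<Sum>(i, j)\<in>{(i, j). i \<noteq> j}. F 0 ((residues c)(i := residues c i - 1, j := residues c j + 1)) / real (CARD('n) * (CARD('n) - 1)))"
      unfolding game_A'_def
      by (subst pmf_expectation_bind_pmf_of_set[OF ne])
        (auto simp: card_pairs divide_inverse mult.commute residues_def[of c, THEN fun_cong] intro!: sum.cong)
    then show ?thesis
      using N by (simp add: sum_pairs step_A'_def of_nat_diff sum_divide_distrib)
  qed
  have B: "measure_pmf.expectation (game_B \<rho> c) ?f = step_B \<rho> F (residues c)"
  proof -
    have p: "win_prob \<rho> j \<in> {0..1}" for j using win_prob_bounds[OF \<rho>, of j] by simp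
    have "measure_pmf.expectation (bind_pmf (bernoulli_pmf (win_prob \<rho> (of_int (c i)))) (\<lambda>win. return_pmf (c(i := c i + (if win then 1 else - 1))))) ?f
      = win_prob \<rho> (residues c i) * F 1 ((residues c)(i := residues c i + 1)) + lose_prob \<rho> (residues c i) * F (- 1) ((residues c)(i := residues c i - 1))" for i
      using p[of "of_int (c i)"]
      by (subst pmf_expectation_bind[where A = UNIV]) (auto simp: UNIV_bool residues_def[of c, THEN fun_cong] lose_prob_def)
    then show ?thesis
      unfolding game_B_def step_B_def
      by (subst pmf_expectation_bind_pmf_of_set) (auto simp: sum_distrib_left divide_inverse mult.commute)
  qed
  have fin: "finite (set_pmf (if b then game_A' c else game_B \<rho> c))" for b
    using ne by (auto simp: game_A'_def game_B_def set_pmf_of_set)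
  show ?thesis
    unfolding mixed_game_def step_def
    using \<gamma> by (subst pmf_expectation_bind[where A = UNIV]) (auto simp: fin UNIV_bool A B simp del: if_split)
qed

section \<open>Stationary distributions and the Poisson equation\<close>

text \<open>Irreducibility enters through its consequence that every fixed column vector is
  constant.\<close>

locale stochastic_matrix =
  fixes P :: "real^'s^'s"
  assumes nonneg: "0 \<le> P $ x $ y"
    and row_sum: "(\<Sum>y\<in>UNIV. P $ x $ y) = 1"
    and harmonic_const: "P *v h = h \<Longrightarrow> \<exists>c. h = c *\<^sub>R 1"
begin

lemma mult_1 [simp]: "P *v 1 = 1"
  by (simp add: vec_eq_iff matrix_vector_mult_def row_sum)

lemma sum_vector_mult: "(\<Sum>y\<in>UNIV. (w v* P) $ y) = (\<Sum>x\<in>UNIV. w $ x)"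
proof -
  have "(\<Sum>y\<in>UNIV. (w v* P) $ y) = (\<Sum>x\<in>UNIV. \<Sum>y\<in>UNIV. w $ x * P $ x $ y)"
    unfolding vector_matrix_mult_def by simp (rule sum.swap)
  also have "\<dots> = (\<Sum>x\<in>UNIV. w $ x)" by (simp add: row_sum flip: sum_distrib_left)
  finally show ?thesis .
qed

text \<open>If \<open>w\<close> is a left fixed vector, then \<open>\<bar>w\<bar> \<le> \<bar>w\<bar> P\<close> entrywise and both sides have the same sum.\<close>

lemma stationary_exists: "\<exists>\<pi>. stationary P \<pi>"
proof -
  have "\<not> invertible (mat 1 - P)"
  proof
    assume "invertible (mat 1 - P)"
    then have "inj ((*v) (mat 1 - P))"
      using invertible_eq_bij bij_def by metis
    moreover have "(mat 1 - P) *v 1 = (mat 1 - P) *v 0"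
      by (simp add: matrix_vector_mult_diff_rdistrib)
    ultimately have "(1 :: real^'s) = 0" by (meson injD)
    then show False by (simp add: vec_eq_iff)
  qed
  then have "\<not> invertible (transpose (mat 1 - P))"
    by (simp add: invertible_det_nz det_transpose)
  then obtain w where "w \<noteq> 0" "transpose (mat 1 - P) *v w = 0"
    unfolding invertible_left_inverse matrix_left_invertible_ker by blast
  then have w: "w v* P = w"
    by (simp add: vector_matrix_mult_diff_rdistrib)
  define u where "u = (\<chi> x. \<bar>w $ x\<bar>)"
  have le: "u $ y \<le> (u v* P) $ y" for y
  proof -
    have "u $ y = \<bar>\<Sum>x\<in>UNIV. w $ x * P $ x $ y\<bar>"
      using arg_cong[OF w, of "\<lambda>v. \<bar>v $ y\<bar>"] by (simp add: u_def vector_matrix_mult_def)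
    also have "\<dots> \<le> (\<Sum>x\<in>UNIV. \<bar>w $ x * P $ x $ y\<bar>)" by (rule sum_abs)
    also have "\<dots> = (u v* P) $ y" using nonneg by (simp add: vector_matrix_mult_def abs_mult u_def)
    finally show ?thesis .
  qed
  have u: "u v* P = u"
  proof -
    have "(\<Sum>y\<in>UNIV. (u v* P) $ y - u $ y) = 0" by (simp add: sum_subtractf sum_vector_mult)
    then have "\<forall>y. (u v* P) $ y - u $ y = 0"
      using le by (subst (asm) sum_nonneg_eq_0_iff) auto
    then show ?thesis by (simp add: vec_eq_iff)
  qed
  define m where "m = (\<Sum>x\<in>UNIV. u $ x)"
  obtain x where "w $ x \<noteq> 0" using \<open>w \<noteq> 0\<close> by (auto simp: vec_eq_iff)
  then have "0 < u $ x" by (simp add: u_def)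
  then have m: "0 < m" unfolding m_def by (intro sum_pos2[of _ x]) (auto simp: u_def)
  have "((1 / m) *\<^sub>R u) v* P = (1 / m) *\<^sub>R (u v* P)"
    by (simp add: vec_eq_iff vector_matrix_mult_def sum_divide_distrib)
  then have "((1 / m) *\<^sub>R u) v* P = (1 / m) *\<^sub>R u"
    by (simp only: u)
  moreover have "(\<Sum>x\<in>UNIV. ((1 / m) *\<^sub>R u) $ x) = 1"
    using m by (simp add: m_def flip: sum_divide_distrib)
  ultimately have "stationary P ((1 / m) *\<^sub>R u)"
    using m by (auto simp: stationary_def u_def)
  then show ?thesis ..
qed

lemma stationary_inner_mult:
  assumes "stationary P \<pi>"
  shows "\<pi> \<bullet> (P *v h) = \<pi> \<bullet> h"
  using assms by (simp add: stationary_def dot_matrix_vector_mul[symmetric] flip: dot_lmul_matrix)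

lemma rows_mult: "(\<chi> x. \<pi>) *v h = (\<pi> \<bullet> h) *\<^sub>R (1 :: real^'s)"
  by (simp add: vec_eq_iff matrix_vector_mult_def inner_vec_def)

lemma stationary_inner_1: "stationary P \<pi> \<Longrightarrow> \<pi> \<bullet> 1 = 1"
  by (simp add: stationary_def inner_vec_def)

text \<open>Pairing a kernel vector \<open>h\<close> with \<open>\<pi>\<close> annihilates
  \<open>h - P *v h\<close> and leaves \<open>\<pi> \<bullet> h = 0\<close>. Then \<open>h\<close>
  is harmonic, hence constant, and a constant of mean zero is zero.\<close>

lemma fundamental_invertible:
  assumes "stationary P \<pi>"
  shows "invertible (mat 1 - (P - (\<chi> x. \<pi>)))"
  unfolding invertible_left_inverse matrix_left_invertible_ker
proof (intro allI impI)
  fix h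
  assume "(mat 1 - (P - (\<chi> x. \<pi>))) *v h = 0"
  then have h: "h - P *v h + (\<pi> \<bullet> h) *\<^sub>R 1 = 0"
    by (simp add: matrix_vector_mult_diff_rdistrib rows_mult algebra_simps)
  from arg_cong[OF this, of "\<lambda>v. \<pi> \<bullet> v"] have "\<pi> \<bullet> h = 0"
    using assms by (simp add: inner_add_right inner_diff_right stationary_inner_mult stationary_inner_1)
  with h have "P *v h = h" by simp
  then obtain c where c: "h = c *\<^sub>R 1" using harmonic_const by blast
  with \<open>\<pi> \<bullet> h = 0\<close> assms show "h = 0" by (simp add: stationary_inner_1)
qed

text \<open>Every stationary vector, paired with \<open>?A *v h\<close>, gives the same number
  \<open>\<pi> \<bullet> h\<close>, and \<open>?A\<close> is surjective.\<close>

lemma stationary_unique: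
  assumes "stationary P \<pi>" and "stationary P \<pi>'"
  shows "\<pi>' = \<pi>"
proof -
  let ?A = "mat 1 - (P - (\<chi> x. \<pi>))"
  have A: "\<pi>' \<bullet> (?A *v h) = \<pi> \<bullet> h" if "stationary P \<pi>'" for \<pi>' h
    using that
    by (simp add: matrix_vector_mult_diff_rdistrib rows_mult inner_add_right inner_diff_right
        stationary_inner_mult stationary_inner_1)
  have "(\<pi>' - \<pi>) \<bullet> v = 0" for v
  proof -
    obtain h where "v = ?A *v h"
      using fundamental_invertible[OF assms(1)] by (metis invertible_eq_bij bij_def surjD)
    then show ?thesis using A[OF assms(1)] A[OF assms(2)] by (simp add: inner_diff_left)
  qed
  from this[of "\<pi>' - \<pi>"] show ?thesis by simp
qed

lemma stationary_dist: "stationary P (stationary_dist P)"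
  unfolding stationary_dist_def using stationary_exists stationary_unique by (metis theI)

text \<open>Invert \<open>I - P + Pi\<close>. Pairing with the stationary vector shows that the
  preimage of a mean-zero \<open>f\<close> has mean zero, so the rank-one term drops out.\<close>

lemma poisson_equation:
  assumes "stationary_dist P \<bullet> f = 0"
  obtains g where "g - P *v g = f"
proof -
  let ?\<pi> = "stationary_dist P"
  obtain g where g: "f = (mat 1 - (P - (\<chi> x. ?\<pi>))) *v g"
    using fundamental_invertible[OF stationary_dist] by (metis invertible_eq_bij bij_def surjD)
  then have f: "f = g - P *v g + (?\<pi> \<bullet> g) *\<^sub>R 1"
    by (simp add: matrix_vector_mult_diff_rdistrib rows_mult)
  with assms have "?\<pi> \<bullet> g = 0"
    by (simp add: inner_add_right inner_diff_right stationary_inner_mult stationary_inner_1 stationary_dist)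
  with f that show ?thesis by simp
qed

text \<open>The fundamental matrix applied to the drift \<open>f\<close> returns \<open>h\<close> up
  to a constant, so the covariance series hidden in \<open>Z\<close> becomes a single correlation
  with \<open>h\<close>. That correlation is the cross term in the square of the martingale
  increment.\<close>

lemma chain_variance_eq:
  fixes h :: "real^'s"
  assumes h: "\<And>x. (\<Sum>y\<in>UNIV. P $ x $ y * (W $ x $ y - \<mu> + h $ y - h $ x)) = 0"
  shows "chain_variance P W
    = stationary_dist P \<bullet> (\<chi> x. \<Sum>y\<in>UNIV. P $ x $ y * (W $ x $ y - \<mu> + h $ y - h $ x)\<^sup>2)"
proof -
  let ?\<pi> = "stationary_dist P"
  let ?\<Pi> = "(\<chi> x. ?\<pi>) :: real^'s^'s"
  let ?A = "mat 1 - (P - ?\<Pi>)"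
  let ?Z = "fundamental_matrix P"
  define f where "f = (P * W) *v 1"
  have Ph: "P *v h = h - f + \<mu> *\<^sub>R 1"
  proof (rule vec_eq_iff[THEN iffD2], rule allI)
    fix x
    have "(\<Sum>y\<in>UNIV. P $ x $ y * (W $ x $ y - \<mu> + h $ y - h $ x))
      = (\<Sum>y\<in>UNIV. P $ x $ y * W $ x $ y + P $ x $ y * h $ y - (\<mu> + h $ x) * P $ x $ y)"
      by (rule sum.cong) (auto simp: algebra_simps)
    also have "\<dots> = f $ x + (P *v h) $ x - (\<mu> + h $ x)"
      by (simp add: sum.distrib sum_subtractf f_def matrix_vector_mult_def row_sum flip: sum_distrib_left)
    finally show "(P *v h) $ x = (h - f + \<mu> *\<^sub>R 1) $ x" using h[of x] by simp
  qed
  have \<mu>: "?\<pi> \<bullet> f = \<mu>"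
    using arg_cong[OF Ph, of "\<lambda>v. ?\<pi> \<bullet> v"]
    by (simp add: inner_add_right inner_diff_right stationary_inner_mult stationary_inner_1 stationary_dist)
  have Z: "?Z *v (?A *v k) = k" for k
  proof -
    have "?Z ** ?A = mat 1"
      using fundamental_invertible[OF stationary_dist]
      unfolding fundamental_matrix_def matrix_inv_def invertible_def by (rule someI2_ex) auto
    then show ?thesis by (metis matrix_vector_mul_assoc matrix_vector_mul_lid)
  qed
  \<comment> \<open>\<open>?A\<close> fixes the vector 1, so adding a multiple of 1 adjusts the mean
    and makes the preimage of \<open>f\<close> exact.\<close>
  have "?A *v (h + (\<mu> - ?\<pi> \<bullet> h) *\<^sub>R 1) = f"
    by (simp add: matrix_vector_mult_diff_rdistrib matrix_vector_right_distrib rows_mult matrix_vector_mult_scaleR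
        inner_add_right stationary_inner_1 stationary_dist Ph algebra_simps)
  with Z have "?Z *v f = h + (\<mu> - ?\<pi> \<bullet> h) *\<^sub>R 1" by metis
  then have "(?Z - ?\<Pi>) *v f = h - (?\<pi> \<bullet> h) *\<^sub>R 1"
    by (simp add: matrix_vector_mult_diff_rdistrib rows_mult \<mu> algebra_simps)
  then have "((P * W) ** (?Z - ?\<Pi>) ** (P * W)) *v 1 = (P * W) *v h - (?\<pi> \<bullet> h) *\<^sub>R f"
    unfolding matrix_vector_mul_assoc[symmetric] f_def[symmetric]
    by (simp add: matrix_vector_mult_diff_distrib matrix_vector_mult_scaleR f_def)
  then have cv: "chain_variance P W
      = ?\<pi> \<bullet> ((P * W * W) *v 1) - \<mu>\<^sup>2 + 2 * (?\<pi> \<bullet> ((P * W) *v h) - (?\<pi> \<bullet> h) * \<mu>)"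
    by (simp add: chain_variance_def Let_def f_def[symmetric] \<mu> inner_diff_right)
  \<comment> \<open>The square is expanded and \<open>P *v h\<close> is eliminated by the drift
    equation. The last summand \<open>P *v (h * h) - h * h\<close> has stationary mean zero.\<close>
  have v: "(\<chi> x. \<Sum>y\<in>UNIV. P $ x $ y * (W $ x $ y - \<mu> + h $ y - h $ x)\<^sup>2)
    = (P * W * W) *v 1 - \<mu>\<^sup>2 *\<^sub>R 1 + 2 *\<^sub>R ((P * W) *v h - \<mu> *\<^sub>R h) + (P *v (h * h) - h * h)"
  proof (rule vec_eq_iff[THEN iffD2], rule allI)
    fix x
    have "(\<Sum>y\<in>UNIV. P $ x $ y * (W $ x $ y - \<mu> + h $ y - h $ x)\<^sup>2)
      = (\<Sum>y\<in>UNIV. P $ x $ y * W $ x $ y * W $ x $ y + 2 * (P $ x $ y * W $ x $ y * h $ y)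
          + P $ x $ y * (h $ y * h $ y) + (\<mu> + h $ x)\<^sup>2 * P $ x $ y
          - 2 * (\<mu> + h $ x) * (P $ x $ y * W $ x $ y) - 2 * (\<mu> + h $ x) * (P $ x $ y * h $ y))"
      by (rule sum.cong) (auto simp: algebra_simps power2_eq_square)
    also have "\<dots> = ((P * W * W) *v 1) $ x + 2 * ((P * W) *v h) $ x + (P *v (h * h)) $ x + (\<mu> + h $ x)\<^sup>2
        - 2 * (\<mu> + h $ x) * f $ x - 2 * (\<mu> + h $ x) * (P *v h) $ x"
      by (simp only: sum.distrib sum_subtractf sum_distrib_left[symmetric] row_sum)
        (simp add: f_def matrix_vector_mult_def)
    finally show "(\<chi> x. \<Sum>y\<in>UNIV. P $ x $ y * (W $ x $ y - \<mu> + h $ y - h $ x)\<^sup>2) $ x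
      = ((P * W * W) *v 1 - \<mu>\<^sup>2 *\<^sub>R 1 + 2 *\<^sub>R ((P * W) *v h - \<mu> *\<^sub>R h) + (P *v (h * h) - h * h)) $ x"
      by (simp add: Ph power2_eq_square algebra_simps)
  qed
  show ?thesis
    unfolding cv v
    by (simp add: inner_add_right inner_diff_right stationary_inner_mult stationary_inner_1 stationary_dist algebra_simps)
qed

end

section \<open>The transition matrix of the residues\<close>

lemma three_neq: "(j::3) + 1 \<noteq> j" "j - 1 \<noteq> j" "j + 1 \<noteq> j - 1" "j - 1 \<noteq> j + 1"
proof -
  have "(1::3) \<noteq> 0" "(1::3) + 1 \<noteq> 0" by simp_all
  then show "j + 1 \<noteq> j" "j - 1 \<noteq> j" "j + 1 \<noteq> j - 1" "j - 1 \<noteq> j + 1"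
    by (auto simp: algebra_simps dest: add_left_imp_eq)
qed

lemma upd_iff: "y = x(i := a) \<longleftrightarrow> y i = a \<and> (\<forall>j. j \<noteq> i \<longrightarrow> y j = x j)"
  by (auto simp: fun_eq_iff)

lemma upd_neq:
  fixes x :: "'n \<Rightarrow> 3"
  shows "x(i := x i + 1) \<noteq> x(j := x j - 1)"
  using three_neq[of "x i"] three_neq[of "x j"] by (metis fun_upd_apply)

lemma payoff_eq:
  "payoff $ x $ y = (if \<exists>i. y = x(i := x i + 1) then 1 else if \<exists>i. y = x(i := x i - 1) then - 1 else 0)"
  by (simp only: payoff_def upd_iff vec_lambda_beta)

lemma payoff_up [simp]: "payoff $ x $ (x(i := x i + 1)) = 1"
  unfolding payoff_eq by (simp only: if_P[OF exI[of _ i]])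

lemma payoff_down [simp]: "payoff $ x $ (x(i := x i - 1)) = - 1"
proof -
  have "\<not> (\<exists>j. x(i := x i - 1) = x(j := x j + 1))" using upd_neq by metis
  then show ?thesis unfolding payoff_eq by (simp only: if_False if_P[OF exI[of _ i]])
qed

lemma payoff_transfer [simp]:
  assumes "i \<noteq> j"
  shows "payoff $ x $ (x(i := x i - 1, j := x j + 1)) = 0"
proof -
  have "x(i := x i - 1, j := x j + 1) \<noteq> x(k := a)" for k a
  proof
    assume eq: "x(i := x i - 1, j := x j + 1) = x(k := a)"
    have "i = k" "j = k"
      using fun_cong[OF eq, of i] fun_cong[OF eq, of j] assms three_neq by (auto split: if_splits)
    with assms show False by simp
  qed
  then have "\<not> (\<exists>k. x(i := x i - 1, j := x j + 1) = x(k := x k + 1))"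
    "\<not> (\<exists>k. x(i := x i - 1, j := x j + 1) = x(k := x k - 1))" by blast+
  then show ?thesis unfolding payoff_eq by (simp only: if_False)
qed

lemma sum_P_B:
  fixes x :: "'n::finite \<Rightarrow> 3"
  shows "(\<Sum>y\<in>UNIV. P_B \<rho> $ x $ y * G (payoff $ x $ y) y) = step_B \<rho> (\<lambda>k. G (of_int k)) x"
proof -
  have "(\<Sum>y\<in>UNIV. P_B \<rho> $ x $ y * G (payoff $ x $ y) y)
    = (\<Sum>i\<in>UNIV. \<Sum>y\<in>UNIV. (if y = x(i := x i + 1) then win_prob \<rho> (x i) / real CARD('n)
        else if y = x(i := x i - 1) then lose_prob \<rho> (x i) / real CARD('n) else 0) * G (payoff $ x $ y) y)"
    by (subst sum.swap) (simp only: P_B_def upd_iff vec_lambda_beta sum_distrib_right)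
  also have "\<dots> = (\<Sum>i\<in>UNIV. \<Sum>y\<in>UNIV.
        (if y = x(i := x i + 1) then win_prob \<rho> (x i) / real CARD('n) * G 1 (x(i := x i + 1)) else 0)
        + (if y = x(i := x i - 1) then lose_prob \<rho> (x i) / real CARD('n) * G (- 1) (x(i := x i - 1)) else 0))"
    using upd_neq[of x] by (intro sum.cong refl) auto
  also have "\<dots> = step_B \<rho> (\<lambda>k. G (of_int k)) x"
    by (simp add: sum.distrib step_B_def sum_divide_distrib add_divide_distrib)
  finally show ?thesis .
qed

text \<open>The matrix assigns its weight once to each reachable target, whereas the game sums over
  ordered pairs. These agree because giver and receiver can be read off the target: -1, 0 and 1 are
  distinct modulo 3.\<close>

lemma sum_P_A':
  fixes x :: "'n::finite \<Rightarrow> 3"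
  shows "(\<Sum>y\<in>UNIV. P_A' $ x $ y * G (payoff $ x $ y) y) = step_A' (\<lambda>k. G (of_int k)) x"
proof -
  define \<phi> where "\<phi> = (\<lambda>(i, j). x(i := x i - 1, j := x j + 1))"
  have \<phi>_iff: "y = \<phi> (i, j) \<longleftrightarrow> y i = x i - 1 \<and> y j = x j + 1 \<and> (\<forall>k. k \<noteq> i \<and> k \<noteq> j \<longrightarrow> y k = x k)"
    if "i \<noteq> j" for i j y
    using that by (auto simp: \<phi>_def fun_eq_iff)
  have "y \<in> \<phi> ` {(i, j). i \<noteq> j} \<longleftrightarrow> (\<exists>i j. i \<noteq> j \<and> y = \<phi> (i, j))" for y by auto
  then have mem: "y \<in> \<phi> ` {(i, j). i \<noteq> j}
      \<longleftrightarrow> (\<exists>i j. i \<noteq> j \<and> y i = x i - 1 \<and> y j = x j + 1 \<and> (\<forall>k. k \<noteq> i \<and> k \<noteq> j \<longrightarrow> y k = x k))" for y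
    using \<phi>_iff by (simp cong: conj_cong)
  have P_A'_entry: "P_A' $ x $ y = (if y \<in> \<phi> ` {(i, j). i \<noteq> j} then 1 / (real CARD('n) * (real CARD('n) - 1)) else 0)" for y
    by (simp only: P_A'_def mem vec_lambda_beta)
  have inj: "inj_on \<phi> {(i, j). i \<noteq> j}"
  proof (rule inj_onI, clarify)
    fix i j k l assume "i \<noteq> j" "k \<noteq> l" "\<phi> (i, j) = \<phi> (k, l)"
    then have eq: "x(i := x i - 1, j := x j + 1) = x(k := x k - 1, l := x l + 1)" by (simp add: \<phi>_def)
    show "i = k \<and> j = l"
      using fun_cong[OF eq, of i] fun_cong[OF eq, of j] \<open>i \<noteq> j\<close> \<open>k \<noteq> l\<close> three_neq
      by (auto split: if_splits)
  qed
  let ?c = "1 / (real CARD('n) * (real CARD('n) - 1))"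
  have "(\<Sum>y\<in>UNIV. P_A' $ x $ y * G (payoff $ x $ y) y)
      = (\<Sum>y\<in>UNIV. if y \<in> \<phi> ` {(i, j). i \<noteq> j} then ?c * G (payoff $ x $ y) y else 0)"
    by (intro sum.cong refl) (simp add: P_A'_entry)
  also have "\<dots> = (\<Sum>y\<in>\<phi> ` {(i, j). i \<noteq> j}. ?c * G (payoff $ x $ y) y)"
    by (simp add: sum.If_cases)
  also have "\<dots> = (\<Sum>(i, j)\<in>{(i, j). i \<noteq> j}. ?c * G 0 (x(i := x i - 1, j := x j + 1)))"
    by (subst sum.reindex[OF inj]) (auto simp: \<phi>_def intro!: sum.cong)
  also have "\<dots> = step_A' (\<lambda>k. G (of_int k)) x"
    by (simp add: sum_pairs step_A'_def sum_divide_distrib)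
  finally show ?thesis .
qed

lemma sum_P_mixed:
  "(\<Sum>y\<in>UNIV. P_mixed \<rho> \<gamma> $ x $ y * G (payoff $ x $ y) y) = step \<rho> \<gamma> (\<lambda>k. G (of_int k)) x"
  by (simp add: P_mixed_def step_def sum_P_A'[symmetric] sum_P_B[symmetric] distrib_right sum.distrib sum_distrib_left mult.assoc)

lemma step_const:
  fixes x :: "'n::finite \<Rightarrow> 3"
  assumes "CARD('n) \<ge> 2"
  shows "step \<rho> \<gamma> (\<lambda>_ _. a) x = a"
  using assms by (simp add: step_def step_A'_def step_B_def lose_prob_def card_Diff_singleton of_nat_diff flip: distrib_right)

lemma P_mixed_up_pos:
  fixes x :: "'n::finite \<Rightarrow> 3"
  assumes \<rho>: "0 < \<rho>" and \<gamma>: "0 \<le> \<gamma>" "\<gamma> < 1"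
  shows "0 < P_mixed \<rho> \<gamma> $ x $ (x(i := x i + 1))"
proof -
  note win_prob_bounds[OF \<rho>]
  then have nonneg: "0 \<le> win_prob \<rho> j" "0 \<le> lose_prob \<rho> j" for j
    by (auto simp: lose_prob_def less_imp_le)
  have "0 < P_B \<rho> $ x $ (x(i := x i + 1))"
    unfolding P_B_def vec_lambda_beta
    using win_prob_bounds[OF \<rho>] by (intro sum_pos2[of _ i]) (auto simp: nonneg)
  moreover have "0 \<le> P_A' $ x $ (x(i := x i + 1))"
    by (simp add: P_A'_def)
  ultimately show ?thesis using \<gamma> by (simp add: P_mixed_def add_nonneg_pos)
qed

lemma P_mixed_nonneg:
  fixes x :: "'n::finite \<Rightarrow> 3"
  assumes \<rho>: "0 < \<rho>" and \<gamma>: "0 \<le> \<gamma>" "\<gamma> \<le> 1"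
  shows "0 \<le> P_mixed \<rho> \<gamma> $ x $ y"
proof -
  note win_prob_bounds[OF \<rho>]
  then have nonneg: "0 \<le> win_prob \<rho> j" "0 \<le> lose_prob \<rho> j" for j
    by (auto simp: lose_prob_def less_imp_le)
  show ?thesis
    using \<gamma> unfolding P_mixed_def P_A'_def P_B_def
    by (auto intro!: add_nonneg_nonneg mult_nonneg_nonneg sum_nonneg nonneg divide_nonneg_nonneg simp: nonneg)
qed

text \<open>The maximum principle: a maximum of a harmonic function spreads along the moves \<open>x i \<mapsto> x i + 1\<close>, which reach every state.\<close>

lemma stochastic_matrix_P_mixed:
  assumes N: "CARD('n::finite) \<ge> 2" and \<rho>: "0 < \<rho>" and \<gamma>: "0 \<le> \<gamma>" "\<gamma> < 1"
  shows "stochastic_matrix (P_mixed \<rho> \<gamma> :: real^('n \<Rightarrow> 3)^('n \<Rightarrow> 3))"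
proof
  let ?P = "P_mixed \<rho> \<gamma> :: real^('n \<Rightarrow> 3)^('n \<Rightarrow> 3)"
  show nonneg: "0 \<le> ?P $ x $ y" for x y using \<gamma> by (intro P_mixed_nonneg \<rho>) auto
  show row_sum: "(\<Sum>y\<in>UNIV. ?P $ x $ y) = 1" for x
    using sum_P_mixed[of \<rho> \<gamma> x "\<lambda>_ _. 1"] step_const[OF N] by simp
  fix h :: "real^('n \<Rightarrow> 3)"
  assume h: "?P *v h = h"
  define m where "m = Max (range (($) h))"
  have m: "h $ x \<le> m" for x unfolding m_def by (rule Max_ge) auto
  have "m \<in> range (($) h)" unfolding m_def by (rule Max_in) auto
  then obtain x0 where x0: "h $ x0 = m" by auto
  have up: "h $ (x(i := x i + 1)) = m" if "h $ x = m" for x i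
  proof -
    have "(\<Sum>y\<in>UNIV. ?P $ x $ y * (m - h $ y)) = m - (?P *v h) $ x"
      by (simp add: right_diff_distrib sum_subtractf row_sum matrix_vector_mult_def flip: sum_distrib_right)
    also have "\<dots> = 0" by (simp add: h that)
    finally have "\<forall>y\<in>UNIV. ?P $ x $ y * (m - h $ y) = 0"
      by (subst (asm) sum_nonneg_eq_0_iff) (auto intro!: mult_nonneg_nonneg nonneg simp: m)
    then have "?P $ x $ (x(i := x i + 1)) * (m - h $ (x(i := x i + 1))) = 0" by blast
    then show ?thesis using P_mixed_up_pos[OF \<rho> \<gamma>, of x i] by simp
  qed
  have upd: "h $ (x(i := a)) = m" if x: "h $ x = m" for x i a
  proof -
    have 1: "h $ (x(i := x i + 1)) = m" by (rule up[OF x])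
    have 2: "h $ (x(i := x i + 1 + 1)) = m" using up[OF 1, of i] by simp
    have "\<forall>j a :: 3. a = j \<or> a = j + 1 \<or> a = j + 1 + 1" by (simp add: forall_3)
    then show ?thesis using 1 2 x by (metis fun_upd_triv)
  qed
  have "h $ (\<lambda>i. if i \<in> A then y i else x0 i) = m" for y and A :: "'n set"
  proof (induction A rule: finite_induct[OF finite])
    case (2 i A)
    have "(\<lambda>k. if k \<in> insert i A then y k else x0 k) = (\<lambda>k. if k \<in> A then y k else x0 k)(i := y i)"
      by auto
    then show ?case using upd[OF 2(3)] by simp
  qed (simp add: x0)
  from this[where A = UNIV] have "h $ y = m" for y by simp
  then have "h = m *\<^sub>R 1" by (simp add: vec_eq_iff)
  then show "\<exists>c. h = c *\<^sub>R 1" ..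
qed

section \<open>Sums over players and over pairs of players\<close>

definition site_sum :: "(3 \<Rightarrow> real) \<Rightarrow> ('n::finite \<Rightarrow> 3) \<Rightarrow> real" where
  "site_sum \<phi> x = (\<Sum>i\<in>UNIV. \<phi> (x i))"

text \<open>The diagonal pairs \<open>i = j\<close> are included; this makes it a nested
  \<open>site_sum\<close>, so that its update formula follows from the one for single sums.\<close>

definition pair_sum :: "(3 \<Rightarrow> 3 \<Rightarrow> real) \<Rightarrow> ('n::finite \<Rightarrow> 3) \<Rightarrow> real" where
  "pair_sum G x = site_sum (\<lambda>a. site_sum (G a) x) x"

lemma site_sum_upd: "site_sum \<phi> (x(i := a)) = site_sum \<phi> x - \<phi> (x i) + \<phi> a"
proof -
  have "site_sum \<phi> (x(i := a)) = \<phi> a + (\<Sum>k\<in>UNIV - {i}. \<phi> (x k))"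
    unfolding site_sum_def by (subst sum.remove[of _ i]) (auto intro!: sum.cong)
  moreover have "site_sum \<phi> x = \<phi> (x i) + (\<Sum>k\<in>UNIV - {i}. \<phi> (x k))"
    unfolding site_sum_def by (subst sum.remove[of _ i]) auto
  ultimately show ?thesis by simp
qed

text \<open>For symmetric \<open>G\<close> this is a quadratic form in the occupation numbers of the
  three residues. The update adds the unit vector of \<open>a\<close> and removes that of
  \<open>x i\<close>; the summands are the constant, linear and quadratic parts of the
  expansion.\<close>

lemma pair_sum_upd:
  assumes sym: "\<And>a b. G a b = G b a"
  shows "pair_sum G (x(i := a)) = pair_sum G x + 2 * (site_sum (G a) x - site_sum (G (x i)) x)
    + (G a a - 2 * G a (x i) + G (x i) (x i))"
proof -
  have "site_sum (\<lambda>b. site_sum (G b) (x(i := a))) x = pair_sum G x - site_sum (G (x i)) x + site_sum (G a) x"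
    unfolding site_sum_upd
    by (simp add: site_sum_def pair_sum_def sum.distrib sum_subtractf sym[of _ "x i"] sym[of _ a])
  then show ?thesis
    by (simp add: pair_sum_def site_sum_upd[of "\<lambda>b. site_sum (G b) (x(i := a))"])
      (simp add: site_sum_upd sym[of "x i" a])
qed

lemma sum_pairs_swap:
  fixes f :: "'n::finite \<Rightarrow> 'n \<Rightarrow> real"
  shows "(\<Sum>i\<in>UNIV. \<Sum>j\<in>UNIV - {i}. f i j) = (\<Sum>i\<in>UNIV. \<Sum>j\<in>UNIV - {i}. f j i)"
proof -
  have eq: "(\<Sum>i\<in>UNIV. \<Sum>j\<in>UNIV - {i}. f i j) = (\<Sum>i\<in>UNIV. \<Sum>j\<in>UNIV. if j \<noteq> i then f i j else 0)" for f :: "'n \<Rightarrow> 'n \<Rightarrow> real"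
    by (intro sum.cong refl sum.mono_neutral_cong_left) auto
  show ?thesis unfolding eq by (subst sum.swap) (intro sum.cong refl, auto)
qed

lemma sum_pairs_const:
  fixes f :: "'n::finite \<Rightarrow> real"
  assumes "CARD('n) \<ge> 2"
  shows "(\<Sum>i\<in>UNIV. \<Sum>j\<in>UNIV - {i}. f i) = (real CARD('n) - 1) * (\<Sum>i\<in>UNIV. f i)"
  using assms by (simp add: sum_distrib_left card_Diff_singleton of_nat_diff)

text \<open>Only the symmetric part of a function of ordered pairs survives summation, so conditions
  on pairs of residues need to hold only after adding both orders.\<close>

lemma sum_pairs_symmetrize:
  fixes x :: "'n::finite \<Rightarrow> 'a"
  assumes N: "CARD('n) \<ge> 2" and E: "\<And>a b. E a b + E b a = 2 * v"
  shows "(\<Sum>i\<in>UNIV. \<Sum>j\<in>UNIV - {i}. E (x i) (x j)) = v * (real CARD('n) * (real CARD('n) - 1))"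
proof -
  let ?s = "\<Sum>i\<in>UNIV. \<Sum>j\<in>UNIV - {i}. E (x i) (x j)"
  have "2 * ?s = ?s + (\<Sum>i\<in>UNIV. \<Sum>j\<in>UNIV - {i}. E (x j) (x i))"
    using sum_pairs_swap[of "\<lambda>i j. E (x i) (x j)"] by simp
  also have "\<dots> = (\<Sum>i\<in>(UNIV :: 'n set). \<Sum>j\<in>UNIV - {i}. 2 * v)"
    by (simp only: sum.distrib[symmetric] E)
  also have "\<dots> = 2 * (v * (real CARD('n) * (real CARD('n) - 1)))"
    unfolding sum_pairs_const[OF N] by simp
  finally show ?thesis by simp
qed

text \<open>Puts both games under one sum over ordered pairs, so that a Poisson equation becomes a
  condition on two residues. A play of \<open>B\<close> by player \<open>i\<close> is counted once
  for each of the \<open>N - 1\<close> partners.\<close>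

lemma step_eq_pairs:
  fixes x :: "'n::finite \<Rightarrow> 3"
  assumes N: "CARD('n) \<ge> 2"
  shows "step \<rho> \<gamma> F x = (\<Sum>i\<in>UNIV. \<Sum>j\<in>UNIV - {i}. \<gamma> * F 0 (x(i := x i - 1, j := x j + 1))
      + (1 - \<gamma>) * (win_prob \<rho> (x i) * F 1 (x(i := x i + 1)) + lose_prob \<rho> (x i) * F (- 1) (x(i := x i - 1))))
      / (real CARD('n) * (real CARD('n) - 1))"
proof -
  define A where "A i j = F 0 (x(i := x i - 1, j := x j + 1))" for i j
  define B where "B i = win_prob \<rho> (x i) * F 1 (x(i := x i + 1)) + lose_prob \<rho> (x i) * F (- 1) (x(i := x i - 1))" for i
  have "(\<Sum>i\<in>UNIV. \<Sum>j\<in>UNIV - {i}. \<gamma> * A i j + (1 - \<gamma>) * B i)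
    = \<gamma> * (\<Sum>i\<in>UNIV. \<Sum>j\<in>UNIV - {i}. A i j) + (1 - \<gamma>) * ((real CARD('n) - 1) * (\<Sum>i\<in>UNIV. B i))"
    by (simp only: sum.distrib sum_distrib_left[symmetric] sum_pairs_const[OF N])
  then show ?thesis
    using N unfolding A_def[symmetric] B_def[symmetric]
    by (simp add: step_def step_A'_def step_B_def A_def[symmetric] B_def[symmetric] add_divide_distrib)
qed

text \<open>The generator of the motion of the residue of a single player, sped up by the factor \<open>N\<close>.\<close>

definition site_gen :: "real \<Rightarrow> real \<Rightarrow> (3 \<Rightarrow> real) \<Rightarrow> 3 \<Rightarrow> real" where
  "site_gen \<rho> \<gamma> \<phi> a = (1 - \<gamma>) * (win_prob \<rho> a * \<phi> (a + 1) + lose_prob \<rho> a * \<phi> (a - 1) - \<phi> a)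
     + \<gamma> * (\<phi> (a + 1) + \<phi> (a - 1) - 2 * \<phi> a)"

text \<open>In \<open>A'\<close> a player gives and receives equally often. After symmetrisation the
  pair term therefore separates into the one-player equations at \<open>a\<close> and at
  \<open>b\<close>, each with right-hand side \<open>\<mu>\<close>.\<close>

lemma step_drift:
  fixes x :: "'n::finite \<Rightarrow> 3"
  assumes N: "CARD('n) \<ge> 2"
    and \<eta>: "\<And>a. (1 - \<gamma>) * (win_prob \<rho> a - lose_prob \<rho> a) + site_gen \<rho> \<gamma> \<eta> a = \<mu>"
  shows "step \<rho> \<gamma> (\<lambda>k y. of_int k - \<mu> + site_sum \<eta> y - site_sum \<eta> x) x = 0"
proof -
  define E where "E a b = \<gamma> * (\<eta> (a - 1) - \<eta> a + \<eta> (b + 1) - \<eta> b - \<mu>)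
    + (1 - \<gamma>) * (win_prob \<rho> a * (1 - \<mu> + \<eta> (a + 1) - \<eta> a) + lose_prob \<rho> a * (- 1 - \<mu> + \<eta> (a - 1) - \<eta> a))" for a b
  have "E a b + E b a = 2 * 0" for a b
    using \<eta>[of a] \<eta>[of b] unfolding E_def site_gen_def lose_prob_def by (simp add: algebra_simps)
  from sum_pairs_symmetrize[of E, OF N this, of x]
  have 0: "(\<Sum>i\<in>UNIV. \<Sum>j\<in>UNIV - {i}. E (x i) (x j)) = 0" by simp
  have "step \<rho> \<gamma> (\<lambda>k y. of_int k - \<mu> + site_sum \<eta> y - site_sum \<eta> x) x
    = (\<Sum>i\<in>UNIV. \<Sum>j\<in>UNIV - {i}. E (x i) (x j)) / (real CARD('n) * (real CARD('n) - 1))"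
    unfolding step_eq_pairs[OF N]
    by (intro arg_cong2[where f = "(/)"] refl sum.cong) (auto simp: site_sum_upd E_def algebra_simps)
  with 0 show ?thesis by simp
qed

lemma site_gen_site_sum:
  "site_gen \<rho> \<gamma> (\<lambda>a. site_sum (G a) x) a = site_sum (\<lambda>b. site_gen \<rho> \<gamma> (\<lambda>c. G c b) a) x"
  by (simp add: site_gen_def site_sum_def sum.distrib sum_subtractf sum_distrib_left algebra_simps)

lemma step_add: "step \<rho> \<gamma> (\<lambda>k y. F k y + G k y) x = step \<rho> \<gamma> F x + step \<rho> \<gamma> G x"
  by (simp add: step_def step_A'_def step_B_def sum.distrib distrib_left add_divide_distrib)

text \<open>The quadratic form \<open>G\<close> evaluated at the unit vector of \<open>b\<close>
  minus that of \<open>a\<close>: the quadratic part in \<open>pair_sum_upd\<close>.\<close>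

definition self_increment :: "(3 \<Rightarrow> 3 \<Rightarrow> real) \<Rightarrow> 3 \<Rightarrow> 3 \<Rightarrow> real" where
  "self_increment G a b = G b b - 2 * G b a + G a a"

text \<open>
  The contribution of the ordered pair of players with residues \<open>a\<close> and \<open>b\<close> to the one-step mean of
  the squared martingale increment plus the increment of \<open>pair_sum G + site_sum \<kappa>\<close>. The plays of \<open>B\<close>
  by the first player are spread evenly over his \<open>N - 1\<close> partners.
\<close>

definition pair_rate :: "real \<Rightarrow> real \<Rightarrow> real \<Rightarrow> real \<Rightarrow> (3 \<Rightarrow> real) \<Rightarrow> (3 \<Rightarrow> real) \<Rightarrow> (3 \<Rightarrow> 3 \<Rightarrow> real) \<Rightarrow> 3 \<Rightarrow> 3 \<Rightarrow> real" where
  "pair_rate N \<rho> \<gamma> \<mu> \<eta> \<kappa> G a b =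
     \<gamma> * ((\<eta> (a - 1) - \<eta> a + \<eta> (b + 1) - \<eta> b - \<mu>)\<^sup>2 + \<kappa> (a - 1) - \<kappa> a + \<kappa> (b + 1) - \<kappa> b
       + self_increment G a (a - 1) + self_increment G b (b + 1)
       + 2 * (G (a - 1) (b + 1) - G (a - 1) b - G a (b + 1) + G a b))
     + (1 - \<gamma>) * (win_prob \<rho> a * ((1 - \<mu> + \<eta> (a + 1) - \<eta> a)\<^sup>2 + \<kappa> (a + 1) - \<kappa> a + self_increment G a (a + 1))
       + lose_prob \<rho> a * ((- 1 - \<mu> + \<eta> (a - 1) - \<eta> a)\<^sup>2 + \<kappa> (a - 1) - \<kappa> a + self_increment G a (a - 1)))
     + 2 * site_gen \<rho> \<gamma> (\<lambda>c. G c a) a + 2 * (N - 1) * site_gen \<rho> \<gamma> (\<lambda>c. G c b) a"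

text \<open>The terms linear in the update involve \<open>R\<close>, which depends on the whole
  configuration. Symmetrisation collects them into \<open>site_gen\<close> applied to
  \<open>R\<close>. Writing \<open>R\<close> as a sum over players and separating the player himself
  from the \<open>N - 1\<close> others gives the last two terms of \<open>pair_rate\<close>, and a
  condition on two residues remains.\<close>

lemma step_variance:
  fixes x :: "'n::finite \<Rightarrow> 3"
  assumes N: "CARD('n) \<ge> 2" and sym: "\<And>a b. G a b = G b a"
    and rate: "\<And>a b. pair_rate (real CARD('n)) \<rho> \<gamma> \<mu> \<eta> \<kappa> G a b + pair_rate (real CARD('n)) \<rho> \<gamma> \<mu> \<eta> \<kappa> G b a = 2 * v"
  defines "g \<equiv> \<lambda>x. pair_sum G x + site_sum \<kappa> x"
  shows "step \<rho> \<gamma> (\<lambda>k y. (of_int k - \<mu> + site_sum \<eta> y - site_sum \<eta> x)\<^sup>2 + g y - g x) x = v"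
proof -
  let ?F = "\<lambda>k y. (of_int k - \<mu> + site_sum \<eta> y - site_sum \<eta> x)\<^sup>2 + g y - g x"
  let ?N = "real CARD('n)"
  let ?E = "pair_rate ?N \<rho> \<gamma> \<mu> \<eta> \<kappa> G"
  define R where "R a = site_sum (G a) x" for a
  define E0 where "E0 a b = ?E a b - 2 * site_gen \<rho> \<gamma> (\<lambda>c. G c a) a - 2 * (?N - 1) * site_gen \<rho> \<gamma> (\<lambda>c. G c b) a" for a b
  define T where "T a b = E0 a b + 2 * (\<gamma> * (R (a - 1) - R a + R (b + 1) - R b)
    + (1 - \<gamma>) * (win_prob \<rho> a * R (a + 1) + lose_prob \<rho> a * R (a - 1) - R a))" for a b
  have g1: "g (x(i := a)) - g x = 2 * (R a - R (x i)) + self_increment G (x i) a + \<kappa> a - \<kappa> (x i)" for i a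
    by (simp add: g_def pair_sum_upd[OF sym] site_sum_upd R_def self_increment_def)
  have g2: "g (x(i := a, j := b)) - g x = 2 * (R a - R (x i) + R b - R (x j)) + self_increment G (x i) a + self_increment G (x j) b
      + 2 * (G a b - G a (x j) - G (x i) b + G (x i) (x j)) + \<kappa> a - \<kappa> (x i) + \<kappa> b - \<kappa> (x j)" if "i \<noteq> j" for i j a b
    using that by (simp add: g_def pair_sum_upd[OF sym] site_sum_upd R_def self_increment_def
        sym[of b "x i"] sym[of b a] sym[of "x j" "x i"] sym[of "x j" a] algebra_simps)
  have T: "\<gamma> * ?F 0 (x(i := x i - 1, j := x j + 1))
      + (1 - \<gamma>) * (win_prob \<rho> (x i) * ?F 1 (x(i := x i + 1)) + lose_prob \<rho> (x i) * ?F (- 1) (x(i := x i - 1)))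
      = T (x i) (x j)" if "i \<noteq> j" for i j
  proof -
    have F0: "?F 0 (x(i := x i - 1, j := x j + 1)) = (\<eta> (x i - 1) - \<eta> (x i) + \<eta> (x j + 1) - \<eta> (x j) - \<mu>)\<^sup>2
      + (g (x(i := x i - 1, j := x j + 1)) - g x)"
      using that by (simp add: site_sum_upd algebra_simps)
    have F1: "?F 1 (x(i := x i + 1)) = (1 - \<mu> + \<eta> (x i + 1) - \<eta> (x i))\<^sup>2 + (g (x(i := x i + 1)) - g x)"
      by (simp add: site_sum_upd algebra_simps)
    have F2: "?F (- 1) (x(i := x i - 1)) = (- 1 - \<mu> + \<eta> (x i - 1) - \<eta> (x i))\<^sup>2 + (g (x(i := x i - 1)) - g x)"
      by (simp add: site_sum_upd algebra_simps)
    show ?thesis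
      unfolding F0 F1 F2 g1 g2[OF that] T_def E0_def pair_rate_def lose_prob_def by (simp add: algebra_simps)
  qed
  have "step \<rho> \<gamma> ?F x = (\<Sum>i\<in>UNIV. \<Sum>j\<in>UNIV - {i}. T (x i) (x j)) / (?N * (?N - 1))"
    unfolding step_eq_pairs[OF N] using T by (intro arg_cong2[where f = "(/)"] refl sum.cong) auto
  also have "(\<Sum>i\<in>UNIV. \<Sum>j\<in>UNIV - {i}. T (x i) (x j)) = (\<Sum>i\<in>UNIV. \<Sum>j\<in>UNIV - {i}. ?E (x i) (x j))"
  proof -
    \<comment> \<open>The linear terms split into a part of the giver and a part of the receiver.
      Exchanging the names in the latter makes both refer to \<open>x i\<close>, and together they
      form the generator.\<close>
    have 1: "T a b = E0 a b + 2 * (\<gamma> * (R (a - 1) - R a) + (1 - \<gamma>) * (win_prob \<rho> a * R (a + 1) + lose_prob \<rho> a * R (a - 1) - R a))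
        + 2 * (\<gamma> * (R (b + 1) - R b))" for a b
      by (simp add: T_def algebra_simps)
    have "(\<Sum>i\<in>UNIV. \<Sum>j\<in>UNIV - {i}. T (x i) (x j))
      = (\<Sum>i\<in>UNIV. \<Sum>j\<in>UNIV - {i}. E0 (x i) (x j)) + (\<Sum>i\<in>UNIV. \<Sum>j\<in>UNIV - {i}. 2 * site_gen \<rho> \<gamma> R (x i))"
      unfolding 1 sum.distrib
      by (subst sum_pairs_swap[of "\<lambda>i j. 2 * (\<gamma> * (R (x j + 1) - R (x j)))"])
        (simp only: add.assoc sum.distrib[symmetric], simp add: site_gen_def algebra_simps)
    also have "(\<Sum>i\<in>UNIV. \<Sum>j\<in>UNIV - {i}. 2 * site_gen \<rho> \<gamma> R (x i))
      = (?N - 1) * (\<Sum>i\<in>UNIV. 2 * (site_gen \<rho> \<gamma> (\<lambda>c. G c (x i)) (x i) + (\<Sum>j\<in>UNIV - {i}. site_gen \<rho> \<gamma> (\<lambda>c. G c (x j)) (x i))))"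
    proof -
      have "site_gen \<rho> \<gamma> R (x i) = site_gen \<rho> \<gamma> (\<lambda>c. G c (x i)) (x i) + (\<Sum>j\<in>UNIV - {i}. site_gen \<rho> \<gamma> (\<lambda>c. G c (x j)) (x i))" for i
        unfolding R_def site_gen_site_sum unfolding site_sum_def by (rule sum.remove) auto
      then show ?thesis unfolding sum_pairs_const[OF N] by simp
    qed
    also have "\<dots> = (\<Sum>i\<in>UNIV. \<Sum>j\<in>UNIV - {i}. 2 * site_gen \<rho> \<gamma> (\<lambda>c. G c (x i)) (x i))
        + (\<Sum>i\<in>UNIV. \<Sum>j\<in>UNIV - {i}. 2 * (?N - 1) * site_gen \<rho> \<gamma> (\<lambda>c. G c (x j)) (x i))"
      unfolding sum_pairs_const[OF N]
      by (simp add: sum_distrib_left sum.distrib distrib_left mult.assoc mult.left_commute)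
        (intro sum.cong refl, simp add: algebra_simps)
    also have "(\<Sum>i\<in>UNIV. \<Sum>j\<in>UNIV - {i}. E0 (x i) (x j)) + \<dots> = (\<Sum>i\<in>UNIV. \<Sum>j\<in>UNIV - {i}. ?E (x i) (x j))"
    proof -
      have "E0 a b + (2 * site_gen \<rho> \<gamma> (\<lambda>c. G c a) a + 2 * (?N - 1) * site_gen \<rho> \<gamma> (\<lambda>c. G c b) a) = ?E a b" for a b
        by (simp add: E0_def)
      then show ?thesis by (simp only: sum.distrib[symmetric])
    qed
    finally show ?thesis .
  qed
  also have "\<dots> = v * (?N * (?N - 1))" by (rule sum_pairs_symmetrize[OF N rate])
  finally show ?thesis using N by simp
qed

section \<open>Solutions of the Poisson equations\<close>

lemma three_cases: "(a::3) = 0 \<or> a = 1 \<or> a = 2"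
proof -
  have "\<forall>a::3. a = 0 \<or> a = 1 \<or> a = 2" by (simp add: forall_3)
  then show ?thesis by blast
qed

lemma three_arith:
  "(1::3) + 1 = 2" "(2::3) + 1 = 0" "(0::3) - 1 = 2" "(2::3) - 1 = 1" "(-1::3) = 2"
  "(2::3) \<noteq> 0" "(2::3) \<noteq> 1" "(1::3) \<noteq> 0" "(3::3) = 0"
  by simp_all

definition triple :: "'a \<Rightarrow> 'a \<Rightarrow> 'a \<Rightarrow> 3 \<Rightarrow> 'a" where
  "triple u v w a = (if a = 0 then u else if a = 1 then v else w)"

lemma triple_simps [simp]: "triple u v w 0 = u" "triple u v w 1 = v" "triple u v w 2 = w"
  by (simp_all add: triple_def)

lemma win_prob_simps: "win_prob \<rho> 0 = \<rho>\<^sup>2 / (1 + \<rho>\<^sup>2)" "win_prob \<rho> 1 = 1 / (1 + \<rho>)" "win_prob \<rho> 2 = 1 / (1 + \<rho>)"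
  by (simp_all add: win_prob_def)

lemma mixed_mean_denominator_pos:
  fixes \<rho> \<gamma> :: real
  assumes "0 < \<rho>" "0 \<le> \<gamma>"
  shows "0 < 2 * (1 + \<rho> + \<rho>\<^sup>2)\<^sup>2 + \<gamma> * (5 + 10 * \<rho> + 6 * \<rho>\<^sup>2 + 10 * \<rho>^3 + 5 * \<rho>^4) + 2 * \<gamma>\<^sup>2 * (1 + \<rho> + \<rho>\<^sup>2)\<^sup>2"
proof -
  have "0 < 1 + \<rho> + \<rho>\<^sup>2" using assms by (simp add: add_pos_pos)
  then have "0 < 2 * (1 + \<rho> + \<rho>\<^sup>2)\<^sup>2" by simp
  moreover have "0 \<le> \<gamma> * (5 + 10 * \<rho> + 6 * \<rho>\<^sup>2 + 10 * \<rho>^3 + 5 * \<rho>^4)" "0 \<le> 2 * \<gamma>\<^sup>2 * (1 + \<rho> + \<rho>\<^sup>2)\<^sup>2"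
    using assms by simp_all
  ultimately show ?thesis by linarith
qed

text \<open>\<open>r0\<close> and \<open>r1\<close> are the upward rates of one player's residue at
  0 and at 1, 2, and \<open>c\<close> is the total rate. By the matrix-tree formula
  \<open>den\<close> is the sum of the spanning-tree weights of this cyclic chain, and
  \<open>c\<^sup>2 - r1 * (c - r1)\<close> is the weight rooted at 0. Hence \<open>\<mu>\<close> is
  the stationary mean of the drift \<open>2 * r - c\<close>.\<close>

lemma drift_solution:
  fixes \<rho> \<gamma> :: real
  assumes \<rho>: "0 < \<rho>" and \<gamma>: "0 \<le> \<gamma>"
  obtains \<eta> where "\<And>a. (1 - \<gamma>) * (win_prob \<rho> a - lose_prob \<rho> a) + site_gen \<rho> \<gamma> \<eta> a = mixed_mean \<rho> \<gamma>"
proof -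
  define c where "c = 1 + \<gamma>"
  define r0 where "r0 = (\<rho>\<^sup>2 + \<gamma>) / (1 + \<rho>\<^sup>2)"
  define r1 where "r1 = (1 + \<gamma> * \<rho>) / (1 + \<rho>)"
  define den where "den = 2 * c\<^sup>2 - r1 * (c - r1) + r0 * r1 + (c - r0) * (c - r1)"
  define t where "t = 2 * (r1 - r0) / den"
  define \<mu> where "\<mu> = 2 * r1 - c - t * (c\<^sup>2 - r1 * (c - r1))"
  define md where "md = 2 * (1 + \<rho> + \<rho>\<^sup>2)\<^sup>2 + \<gamma> * (5 + 10 * \<rho> + 6 * \<rho>\<^sup>2 + 10 * \<rho>^3 + 5 * \<rho>^4) + 2 * \<gamma>\<^sup>2 * (1 + \<rho> + \<rho>\<^sup>2)\<^sup>2"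
  have md: "0 < md" unfolding md_def by (rule mixed_mean_denominator_pos[OF \<rho> \<gamma>])
  have pos: "0 < 1 + \<rho>" "0 < 1 + \<rho>\<^sup>2" using \<rho> by (auto simp: add_pos_pos)
  have r: "r0 * (1 + \<rho>\<^sup>2) = \<rho>\<^sup>2 + \<gamma>" "r1 * (1 + \<rho>) = 1 + \<gamma> * \<rho>" using pos by (auto simp: r0_def r1_def)
  have den: "den * ((1 + \<rho>)\<^sup>2 * (1 + \<rho>\<^sup>2)) = md"
    unfolding den_def md_def c_def using r by algebra
  have den_pos: "den \<noteq> 0" using den md by auto
  have t: "t * den = 2 * (r1 - r0)" using den_pos by (simp add: t_def)
  have "\<mu> * md = 3 * \<gamma> * (1 - \<gamma>) * (1 - \<rho>)^3 * (1 + \<rho>)"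
  proof -
    have "\<mu> * den = (2 * r1 - c) * den - 2 * (r1 - r0) * (c\<^sup>2 - r1 * (c - r1))"
      using t unfolding \<mu>_def by algebra
    moreover have "((2 * r1 - c) * den - 2 * (r1 - r0) * (c\<^sup>2 - r1 * (c - r1))) * ((1 + \<rho>)\<^sup>2 * (1 + \<rho>\<^sup>2)) * (1 + \<rho>)
      = 3 * \<gamma> * (1 - \<gamma>) * (1 - \<rho>)^3 * (1 + \<rho>) * (1 + \<rho>)"
      unfolding den_def c_def using r by algebra
    ultimately show ?thesis using den pos by (metis (no_types, opaque_lifting) less_irrefl mult.assoc mult_right_cancel)
  qed
  then have \<mu>: "\<mu> = mixed_mean \<rho> \<gamma>"
    using md unfolding mixed_mean_def md_def[symmetric] by (simp add: eq_divide_eq)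
  have r_eq: "(1 - \<gamma>) * win_prob \<rho> 0 + \<gamma> = r0" "(1 - \<gamma>) * win_prob \<rho> 1 + \<gamma> = r1" "(1 - \<gamma>) * win_prob \<rho> 2 + \<gamma> = r1"
    using pos by (auto simp: win_prob_simps r0_def r1_def field_simps)
  have gen: "(1 - \<gamma>) * (win_prob \<rho> a - lose_prob \<rho> a) + site_gen \<rho> \<gamma> \<eta> a
      = 2 * r - c + r * \<eta> (a + 1) + (c - r) * \<eta> (a - 1) - c * \<eta> a"
    if "(1 - \<gamma>) * win_prob \<rho> a + \<gamma> = r" for a r \<eta>
    unfolding that[symmetric] by (simp add: site_gen_def lose_prob_def c_def algebra_simps)
  \<comment> \<open>With value 0 at residue 0, the equations at 1 and 2 form a linear system with
    solution proportional to \<open>t\<close>; the equation at 0 then amounts to the definition of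
    \<open>t\<close>.\<close>
  let ?\<eta> = "triple 0 (t * (c + r1)) (t * (c + (c - r1)))"
  have e0: "(1 - \<gamma>) * (win_prob \<rho> 0 - lose_prob \<rho> 0) + site_gen \<rho> \<gamma> ?\<eta> 0 = \<mu>"
    unfolding gen[OF r_eq(1)] \<mu>_def using t unfolding den_def by (simp add: three_arith) algebra
  have e1: "(1 - \<gamma>) * (win_prob \<rho> 1 - lose_prob \<rho> 1) + site_gen \<rho> \<gamma> ?\<eta> 1 = \<mu>"
    unfolding gen[OF r_eq(2)] \<mu>_def by (simp add: three_arith algebra_simps power2_eq_square)
  have e2: "(1 - \<gamma>) * (win_prob \<rho> 2 - lose_prob \<rho> 2) + site_gen \<rho> \<gamma> ?\<eta> 2 = \<mu>"
    unfolding gen[OF r_eq(3)] \<mu>_def by (simp add: three_arith algebra_simps power2_eq_square)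
  have "(1 - \<gamma>) * (win_prob \<rho> a - lose_prob \<rho> a) + site_gen \<rho> \<gamma> ?\<eta> a = \<mu>" for a
    using three_cases[of a] by (elim disjE) (simp_all only: e0 e1 e2)
  then show ?thesis unfolding \<mu> by (rule that)
qed

text \<open>Along the cycle 0, 1, 2, 0 the corrected increments are \<open>D0\<close>,
  \<open>\<rho> * D0\<close> and \<open>\<rho>\<^sup>2 * D0\<close>: centring at 1 and at 2 forces
  the ratio lose/win, which is \<open>\<rho>\<close>, and the sum is 3 because \<open>\<eta>\<close>
  telescopes. This gives \<open>D0 = 3 / s\<close>.\<close>

lemma game_B_solution:
  fixes \<rho> :: real
  assumes \<rho>: "0 < \<rho>"
  obtains \<eta> \<kappa> where
    "\<And>a. (win_prob \<rho> a - lose_prob \<rho> a) + site_gen \<rho> 0 \<eta> a = 0"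
    "\<And>a. win_prob \<rho> a * (1 + \<eta> (a + 1) - \<eta> a)\<^sup>2 + lose_prob \<rho> a * (- 1 + \<eta> (a - 1) - \<eta> a)\<^sup>2 + site_gen \<rho> 0 \<kappa> a
      = (3 * \<rho> / (1 + \<rho> + \<rho>\<^sup>2))\<^sup>2"
proof -
  define s where "s = 1 + \<rho> + \<rho>\<^sup>2"
  have s: "0 < s" using \<rho> by (simp add: s_def add_pos_pos)
  have pos: "0 < 1 + \<rho>" "0 < 1 + \<rho>\<^sup>2" using \<rho> by (auto simp: add_pos_pos)
  define D0 where "D0 = 3 / s"
  define k where "k = 9 * \<rho> * (1 - \<rho>) * (1 + \<rho>) / s ^ 3"
  define p0 where "p0 = win_prob \<rho> 0"
  define p1 where "p1 = win_prob \<rho> 1"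
  have p2: "win_prob \<rho> 2 = p1" by (simp add: p1_def win_prob_simps)
  have p: "p0 * (1 + \<rho>\<^sup>2) = \<rho>\<^sup>2" "p1 * (1 + \<rho>) = 1" using pos by (auto simp: p0_def p1_def win_prob_simps)
  have D0: "D0 * s = 3" using s by (simp add: D0_def)
  have k: "k * s = D0\<^sup>2 * \<rho> * (1 - \<rho>) * (1 + \<rho>)" using s by (simp add: k_def D0_def power2_eq_square power3_eq_cube)
  have target: "(3 * \<rho> / (1 + \<rho> + \<rho>\<^sup>2))\<^sup>2 = D0\<^sup>2 * \<rho>\<^sup>2"
    by (simp add: D0_def s_def power_divide power_mult_distrib)
  \<comment> \<open>At residue 0 the mean square is already
    \<open>D0\<^sup>2 * \<rho>\<^sup>2\<close>, so the values of \<open>\<kappa>\<close> at 1 and 2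
    must be in the ratio \<open>1 : - \<rho>\<^sup>2\<close>. The equation at 1 determines
    \<open>k\<close>.\<close>
  let ?\<eta> = "triple 0 (D0 - 1) (D0 + \<rho> * D0 - 2)" and ?\<kappa> = "triple 0 k (- \<rho>\<^sup>2 * k)"
  note simps = three_arith site_gen_def lose_prob_def p0_def[symmetric] p1_def[symmetric] p2
  have cancel: "x = y" if "x * m = y * m" "0 < m" for x y m :: real using that by simp
  have "(win_prob \<rho> a - lose_prob \<rho> a) + site_gen \<rho> 0 ?\<eta> a = 0" for a
    using three_cases[of a]
  proof (elim disjE; hypsubst)
    show "(win_prob \<rho> 0 - lose_prob \<rho> 0) + site_gen \<rho> 0 ?\<eta> 0 = 0"
      by (rule cancel[OF _ pos(2)], simp add: simps, insert p D0, unfold s_def, algebra)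
    show "(win_prob \<rho> 1 - lose_prob \<rho> 1) + site_gen \<rho> 0 ?\<eta> 1 = 0"
      by (rule cancel[OF _ pos(1)], simp add: simps, insert p D0, unfold s_def, algebra)
    show "(win_prob \<rho> 2 - lose_prob \<rho> 2) + site_gen \<rho> 0 ?\<eta> 2 = 0"
      by (rule cancel[OF _ pos(1)], simp add: simps, insert p D0, unfold s_def, algebra)
  qed
  moreover have "win_prob \<rho> a * (1 + ?\<eta> (a + 1) - ?\<eta> a)\<^sup>2 + lose_prob \<rho> a * (- 1 + ?\<eta> (a - 1) - ?\<eta> a)\<^sup>2 + site_gen \<rho> 0 ?\<kappa> a
      = (3 * \<rho> / (1 + \<rho> + \<rho>\<^sup>2))\<^sup>2" for a
    unfolding target using three_cases[of a]
  proof (elim disjE; hypsubst)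
    have D2: "1 - (D0 + \<rho> * D0 - 2) = \<rho>\<^sup>2 * D0" using D0 unfolding s_def by (simp add: algebra_simps)
    then have D2': "1 + 0 - (D0 + \<rho> * D0 - 2) = \<rho>\<^sup>2 * D0" "-1 + (D0 + \<rho> * D0 - 2) - 0 = - (\<rho>\<^sup>2 * D0)" by linarith+
    have D1: "1 + (D0 + \<rho> * D0 - 2) - (D0 - 1) = \<rho> * D0" "-1 + (D0 - 1) - (D0 + \<rho> * D0 - 2) = - (\<rho> * D0)" by linarith+
    have D0': "1 + (D0 - 1) - 0 = D0" "- 1 + 0 - (D0 - 1) = - D0" by linarith+
    have add: "(0::3) + 1 = 1" "(1::3) - 1 = 0" by simp_all
    show "win_prob \<rho> 0 * (1 + ?\<eta> (0 + 1) - ?\<eta> 0)\<^sup>2 + lose_prob \<rho> 0 * (- 1 + ?\<eta> (0 - 1) - ?\<eta> 0)\<^sup>2 + site_gen \<rho> 0 ?\<kappa> 0 = D0\<^sup>2 * \<rho>\<^sup>2"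
      unfolding add three_arith(1-4) triple_simps D0' D1 D2'
      by (rule cancel[OF _ pos(2)], simp add: simps, insert p, algebra)
    show "win_prob \<rho> 1 * (1 + ?\<eta> (1 + 1) - ?\<eta> 1)\<^sup>2 + lose_prob \<rho> 1 * (- 1 + ?\<eta> (1 - 1) - ?\<eta> 1)\<^sup>2 + site_gen \<rho> 0 ?\<kappa> 1 = D0\<^sup>2 * \<rho>\<^sup>2"
      unfolding add three_arith(1-4) triple_simps D0' D1 D2'
      by (rule cancel[OF _ pos(1)], simp add: simps, insert p k, unfold s_def, algebra)
    show "win_prob \<rho> 2 * (1 + ?\<eta> (2 + 1) - ?\<eta> 2)\<^sup>2 + lose_prob \<rho> 2 * (- 1 + ?\<eta> (2 - 1) - ?\<eta> 2)\<^sup>2 + site_gen \<rho> 0 ?\<kappa> 2 = D0\<^sup>2 * \<rho>\<^sup>2"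
      unfolding add three_arith(1-4) triple_simps D0' D1 D2'
      by (rule cancel[OF _ pos(1)], simp add: simps, insert p k, unfold s_def, algebra)
  qed
  ultimately show ?thesis using that by blast
qed

section \<open>Limit theorems for the mixed game\<close>

lemma additive_functional_game:
  fixes C :: "nat \<Rightarrow> 'w \<Rightarrow> 'n::finite \<Rightarrow> int" and h :: "('n \<Rightarrow> 3) \<Rightarrow> real"
  assumes N: "CARD('n) \<ge> 2" and \<rho>: "0 < \<rho>" and \<gamma>: "0 \<le> \<gamma>" "\<gamma> \<le> 1"
    and mc: "markov_chain_on M (mixed_game \<rho> \<gamma>) C"
    and h: "\<And>x. step \<rho> \<gamma> (\<lambda>k y. of_int k - \<mu> + h y - h x) x = 0"
  obtains d H where "additive_functional M (mixed_game \<rho> \<gamma>) C (\<lambda>c. of_int (capital c) + h (residues c)) \<mu> d"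
    and "\<And>x. \<bar>h x\<bar> \<le> H"
proof -
  define H where "H = Max (range (\<lambda>x. \<bar>h x\<bar>))"
  have H: "\<bar>h x\<bar> \<le> H" for x unfolding H_def by (rule Max_ge) auto
  interpret prob_space M using mc by (simp add: markov_chain_on_def)
  have "additive_functional M (mixed_game \<rho> \<gamma>) C (\<lambda>c. of_int (capital c) + h (residues c)) \<mu> (1 + 2 * H + \<bar>\<mu>\<bar>)"
  proof
    fix c c' :: "'n \<Rightarrow> int"
    assume "c' \<in> set_pmf (mixed_game \<rho> \<gamma> c)"
    then have "\<bar>capital c' - capital c\<bar> \<le> 1" by (rule capital_mixed_game[OF N])
    then have "\<bar>real_of_int (capital c') - real_of_int (capital c)\<bar> \<le> 1" by linarith
    then show "\<bar>of_int (capital c') + h (residues c') - (of_int (capital c) + h (residues c)) - \<mu>\<bar> \<le> 1 + 2 * H + \<bar>\<mu>\<bar>"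
      using H[of "residues c"] H[of "residues c'"] by linarith
  next
    fix c :: "'n \<Rightarrow> int"
    show "measure_pmf.expectation (mixed_game \<rho> \<gamma> c)
        (\<lambda>c'. of_int (capital c') + h (residues c') - (of_int (capital c) + h (residues c)) - \<mu>) = 0"
      using expectation_mixed_game[OF N \<rho> \<gamma>, of c "\<lambda>k y. of_int k - \<mu> + h y - h (residues c)"] h[of "residues c"]
      by (simp add: algebra_simps)
  qed (rule mc)
  then show ?thesis using H that by blast
qed

lemma total_profit_eq: "total_profit C n \<omega> = of_int (capital (C n \<omega>)) - of_int (capital (C 0 \<omega>))"
  by (simp add: total_profit_def capital_def)

lemma game_strong_law:
  fixes C :: "nat \<Rightarrow> 'w \<Rightarrow> 'n::finite \<Rightarrow> int" and h :: "('n \<Rightarrow> 3) \<Rightarrow> real"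
  assumes N: "CARD('n) \<ge> 2" and \<rho>: "0 < \<rho>" and \<gamma>: "0 \<le> \<gamma>" "\<gamma> \<le> 1"
    and mc: "markov_chain_on M (mixed_game \<rho> \<gamma>) C"
    and h: "\<And>x. step \<rho> \<gamma> (\<lambda>k y. of_int k - \<mu> + h y - h x) x = 0"
  shows "AE \<omega> in M. (\<lambda>n. total_profit C n \<omega> / real n) \<longlonglongrightarrow> \<mu>"
proof -
  obtain d H where af: "additive_functional M (mixed_game \<rho> \<gamma>) C (\<lambda>c. of_int (capital c) + h (residues c)) \<mu> d"
    and H: "\<And>x. \<bar>h x\<bar> \<le> H"
    using additive_functional_game[OF assms] by blast
  from additive_functional.strong_law[OF af] show ?thesis
  proof eventually_elim
    case (elim \<omega>)
    have "(\<lambda>n. (h (residues (C n \<omega>)) - h (residues (C 0 \<omega>))) / real n) \<longlonglongrightarrow> 0"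
    proof (rule Lim_null_comparison)
      show "\<forall>\<^sub>F n in sequentially. norm ((h (residues (C n \<omega>)) - h (residues (C 0 \<omega>))) / real n) \<le> 2 * H / real n"
      proof (rule always_eventually, rule allI)
        fix n
        have "\<bar>h (residues (C n \<omega>)) - h (residues (C 0 \<omega>))\<bar> \<le> 2 * H"
          using H[of "residues (C n \<omega>)"] H[of "residues (C 0 \<omega>)"] by linarith
        then show "norm ((h (residues (C n \<omega>)) - h (residues (C 0 \<omega>))) / real n) \<le> 2 * H / real n"
          by (simp add: divide_right_mono)
      qed
      show "(\<lambda>n. 2 * H / real n) \<longlonglongrightarrow> 0" by (rule lim_const_over_n)
    qed
    from tendsto_diff[OF elim this] show ?case
      by (simp add: total_profit_eq diff_divide_distrib add_divide_distrib)
  qed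
qed

lemma game_central_limit:
  fixes C :: "nat \<Rightarrow> 'w \<Rightarrow> 'n::finite \<Rightarrow> int" and h :: "('n \<Rightarrow> 3) \<Rightarrow> real"
  assumes N: "CARD('n) \<ge> 2" and \<rho>: "0 < \<rho>" and \<gamma>: "0 \<le> \<gamma>" "\<gamma> \<le> 1"
    and mc: "markov_chain_on M (mixed_game \<rho> \<gamma>) C"
    and h: "\<And>x. step \<rho> \<gamma> (\<lambda>k y. of_int k - \<mu> + h y - h x) x = 0"
    and g: "\<And>x. step \<rho> \<gamma> (\<lambda>k y. (of_int k - \<mu> + h y - h x)\<^sup>2 + g y - g x) x = v"
    and v: "0 < v"
  shows "weak_conv_m (\<lambda>n. distr M borel (\<lambda>\<omega>. (total_profit C n \<omega> - real n * \<mu>) / sqrt (real n * v)))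
    std_normal_distribution"
proof -
  obtain d H where af: "additive_functional M (mixed_game \<rho> \<gamma>) C (\<lambda>c. of_int (capital c) + h (residues c)) \<mu> d"
    and H: "\<And>x. \<bar>h x\<bar> \<le> H"
    using additive_functional_game[OF N \<rho> \<gamma> mc h] by blast
  interpret additive_functional M "mixed_game \<rho> \<gamma>" C "\<lambda>c. of_int (capital c) + h (residues c)" \<mu> d by (fact af)
  define B where "B = Max (range (\<lambda>x. \<bar>g x\<bar>))"
  have B: "\<bar>g x\<bar> \<le> B" for x unfolding B_def by (rule Max_ge) auto
  have var: "measure_pmf.expectation (mixed_game \<rho> \<gamma> c)
      (\<lambda>c'. (of_int (capital c') + h (residues c') - (of_int (capital c) + h (residues c)) - \<mu>)\<^sup>2 + g (residues c'))
      = g (residues c) + v" for c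
  proof -
    let ?q = "\<lambda>k y. (of_int k - \<mu> + h y - h (residues c))\<^sup>2"
    have "step \<rho> \<gamma> (\<lambda>k y. ?q k y + g y) (residues c)
      = step \<rho> \<gamma> (\<lambda>k y. (?q k y + g y - g (residues c)) + g (residues c)) (residues c)" by simp
    also have "\<dots> = v + g (residues c)"
      unfolding step_add g step_const[OF N] ..
    finally show ?thesis
      using expectation_mixed_game[OF N \<rho> \<gamma>, of c "\<lambda>k y. ?q k y + g y"] by (simp add: algebra_simps)
  qed
  show ?thesis
    unfolding total_profit_eq
    by (rule central_limit[where g = "\<lambda>c. g (residues c)" and B = B and H = H and T = "\<lambda>c. of_int (capital c)"])
      (use B var v H in auto)
qed

text \<open>The first part supplies \<open>g\<close> for general parameters. The second part is its
  converse: an explicit solution with constant \<open>v\<close> identifies the variance without any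
  computation of the stationary distribution.\<close>

lemma mixed_variance_poisson:
  fixes h :: "('n::finite \<Rightarrow> 3) \<Rightarrow> real"
  assumes N: "CARD('n) \<ge> 2" and \<rho>: "0 < \<rho>" and \<gamma>: "0 \<le> \<gamma>" "\<gamma> < 1"
    and h: "\<And>x. step \<rho> \<gamma> (\<lambda>k y. of_int k - \<mu> + h y - h x) x = 0"
  shows "\<exists>g. \<forall>x. step \<rho> \<gamma> (\<lambda>k y. (of_int k - \<mu> + h y - h x)\<^sup>2 + g y - g x) x = mixed_variance TYPE('n) \<rho> \<gamma>"
    and "(\<And>x. step \<rho> \<gamma> (\<lambda>k y. (of_int k - \<mu> + h y - h x)\<^sup>2 + g y - g x) x = v) \<Longrightarrow> mixed_variance TYPE('n) \<rho> \<gamma> = v"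
proof -
  let ?P = "P_mixed \<rho> \<gamma> :: real^('n \<Rightarrow> 3)^('n \<Rightarrow> 3)"
  let ?\<sigma> = "mixed_variance TYPE('n) \<rho> \<gamma>"
  interpret stochastic_matrix ?P by (rule stochastic_matrix_P_mixed[OF N \<rho> \<gamma>])
  define w where "w = (\<chi> x. step \<rho> \<gamma> (\<lambda>k y. (of_int k - \<mu> + h y - h x)\<^sup>2) x)"
  have \<sigma>: "?\<sigma> = stationary_dist ?P \<bullet> w"
  proof -
    have "?\<sigma> = stationary_dist ?P \<bullet> (\<chi> x. \<Sum>y\<in>UNIV. ?P $ x $ y * (payoff $ x $ y - \<mu> + (\<chi> x. h x) $ y - (\<chi> x. h x) $ x)\<^sup>2)"
      unfolding mixed_variance_def
    proof (rule chain_variance_eq)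
      show "(\<Sum>y\<in>UNIV. ?P $ x $ y * (payoff $ x $ y - \<mu> + (\<chi> x. h x) $ y - (\<chi> x. h x) $ x)) = 0" for x
        using sum_P_mixed[of \<rho> \<gamma> x "\<lambda>k y. k - \<mu> + h y - h x"] h[of x] by simp
    qed
    also have "(\<chi> x. \<Sum>y\<in>UNIV. ?P $ x $ y * (payoff $ x $ y - \<mu> + (\<chi> x. h x) $ y - (\<chi> x. h x) $ x)\<^sup>2) = w"
      unfolding w_def vec_eq_iff using sum_P_mixed[of \<rho> \<gamma> _ "\<lambda>k y. (k - \<mu> + h y - h x)\<^sup>2" for x] by simp
    finally show ?thesis .
  qed
  have split: "step \<rho> \<gamma> (\<lambda>k y. (of_int k - \<mu> + h y - h x)\<^sup>2 + g y - g x) x = w $ x + (?P *v (\<chi> y. g y)) $ x - g x" for g x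
  proof -
    have "step \<rho> \<gamma> (\<lambda>k y. (of_int k - \<mu> + h y - h x)\<^sup>2 + g y - g x) x
      = step \<rho> \<gamma> (\<lambda>k y. ((of_int k - \<mu> + h y - h x)\<^sup>2 + g y) + - g x) x" by simp
    also have "\<dots> = w $ x + step \<rho> \<gamma> (\<lambda>k y. g y) x - g x"
      unfolding step_add step_const[OF N] w_def by simp
    also have "step \<rho> \<gamma> (\<lambda>k y. g y) x = (?P *v (\<chi> y. g y)) $ x"
      using sum_P_mixed[of \<rho> \<gamma> x "\<lambda>k y. g y"] by (simp add: matrix_vector_mult_def)
    finally show ?thesis .
  qed
  show "\<exists>g. \<forall>x. step \<rho> \<gamma> (\<lambda>k y. (of_int k - \<mu> + h y - h x)\<^sup>2 + g y - g x) x = ?\<sigma>"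
  proof -
    have "stationary_dist ?P \<bullet> (w - ?\<sigma> *\<^sub>R 1) = 0"
      by (simp add: inner_diff_right \<sigma> stationary_inner_1[OF stationary_dist])
    then obtain g where "g - ?P *v g = w - ?\<sigma> *\<^sub>R 1" by (rule poisson_equation)
    then have "w $ x + (?P *v g) $ x - g $ x = ?\<sigma>" for x
      by (simp add: vec_eq_iff algebra_simps)
    then have "step \<rho> \<gamma> (\<lambda>k y. (of_int k - \<mu> + h y - h x)\<^sup>2 + g $ y - g $ x) x = ?\<sigma>" for x
      using split[where g = "($) g"] by simp
    then show ?thesis by (intro exI[of _ "($) g"]) blast
  qed
  assume g: "step \<rho> \<gamma> (\<lambda>k y. (of_int k - \<mu> + h y - h x)\<^sup>2 + g y - g x) x = v" for x
  have "w + ?P *v (\<chi> y. g y) - (\<chi> y. g y) = v *\<^sub>R 1"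
    using g unfolding split by (simp add: vec_eq_iff)
  from arg_cong[OF this, of "\<lambda>u. stationary_dist ?P \<bullet> u"] show "?\<sigma> = v"
    by (simp add: \<sigma> inner_add_right inner_diff_right stationary_inner_mult[OF stationary_dist] stationary_inner_1[OF stationary_dist])
qed

section \<open>The closed formula for the variance at \<rho> = 1/3, \<gamma> = 1/2\<close>

lemma variance_denominator_pos:
  fixes N :: real
  assumes "2 \<le> N"
  shows "0 < - 269171 + 524347 * N - 338381 * N\<^sup>2 + 72405 * N^3"
proof -
  \<comment> \<open>The Taylor expansion at \<open>N = 2\<close>, all of whose coefficients are
    positive.\<close>
  have "- 269171 + 524347 * N - 338381 * N\<^sup>2 + 72405 * N^3
    = 5239 + 39683 * (N - 2) + 96049 * (N - 2)\<^sup>2 + 72405 * (N - 2)^3"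
    by (simp add: power2_eq_square power3_eq_cube algebra_simps)
  also have "\<dots> > 0" using assms by (intro add_pos_nonneg mult_nonneg_nonneg zero_le_power) auto
  finally show ?thesis .
qed

lemma variance_numerator_pos:
  fixes N :: real
  assumes "2 \<le> N"
  shows "0 < - 36821493886409 + 71724260647553 * N - 46282959184439 * N\<^sup>2 + 9902542819695 * N^3"
proof -
  have "- 36821493886409 + 71724260647553 * N - 46282959184439 * N\<^sup>2 + 9902542819695 * N^3
    = 715533228501 + 5422937746137 * (N - 2) + 13132297733731 * (N - 2)\<^sup>2 + 9902542819695 * (N - 2)^3"
    by (simp add: power2_eq_square power3_eq_cube algebra_simps)
  also have "\<dots> > 0" using assms by (intro add_pos_nonneg mult_nonneg_nonneg zero_le_power) auto
  finally show ?thesis .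
qed

lemma win_lose_prob_third:
  "win_prob (1 / 3) 0 = 1 / 10" "win_prob (1 / 3) 1 = 3 / 4" "win_prob (1 / 3) 2 = 3 / 4"
  "lose_prob (1 / 3) 0 = 9 / 10" "lose_prob (1 / 3) 1 = 1 / 4" "lose_prob (1 / 3) 2 = 1 / 4"
  by (simp_all add: win_prob_simps lose_prob_def power2_eq_square)

text \<open>The mean 48/1609 and the values 494/1609, 442/1609 come from
  \<open>drift_solution\<close>, whose \<open>den\<close> is 1609/320 here; 2588881 is the square of
  1609. The unknowns stay symbolic: the symmetrised rates are affine in them, which later leaves
  only polynomial identities in \<open>N\<close>.\<close>

lemma pair_rate_third_half:
  fixes N g11 g12 g22 k1 k2 :: real
  defines "r \<equiv> pair_rate N (1 / 3) (1 / 2) (48 / 1609) (triple 0 (494 / 1609) (442 / 1609)) (triple 0 k1 k2)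
    (triple (triple 0 0 0) (triple 0 g11 g12) (triple 0 g12 g22))"
  shows
    "r 0 0 + r 0 0 = (2539449 / 2588881) + (11 / 10) * g11 + (2) * g12 + (19 / 10) * g22 + (11 / 10) * k1 + (19 / 10) * k2"
    "r 0 1 + r 1 0 = (2367342 / 2588881) + (-61 / 20 + (11 / 10) * N) * g11 + (-29 / 10 + (19 / 10) * N) * g12 + (113 / 40) * g22 + (-19 / 20) * k1 + (73 / 40) * k2"
    "r 0 2 + r 2 0 = (1792170 / 2588881) + (87 / 40) * g11 + (-21 / 10 + (11 / 10) * N) * g12 + (-69 / 20 + (19 / 10) * N) * g22 + (47 / 40) * k1 + (-11 / 20) * k2"
    "r 1 1 + r 1 1 = (3217347 / 2588881) + (5 + (-6) * N) * g11 + (-11 / 2 + (7 / 2) * N) * g12 + (7 / 4) * g22 + (-3) * k1 + (7 / 4) * k2"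
    "r 1 2 + r 2 1 = (2709099 / 2588881) + (-25 / 8 + (5 / 4) * N) * g11 + (9 + (-6) * N) * g12 + (-27 / 8 + (7 / 4) * N) * g22 + (-7 / 8) * k1 + (-5 / 8) * k2"
    "r 2 2 + r 2 2 = (1774971 / 2588881) + (5 / 4) * g11 + (-9 / 2 + (5 / 2) * N) * g12 + (5 + (-6) * N) * g22 + (5 / 4) * k1 + (-3) * k2"
  unfolding r_def pair_rate_def self_increment_def site_gen_def
  by (simp_all add: win_lose_prob_third three_arith power2_eq_square, simp_all add: field_simps)

text \<open>The six unordered pairs of residues give six equations for the three free entries of
  \<open>G\<close>, the two of \<open>\<kappa>\<close> and the variance. Verifying them replaces a
  computation with the stationary law on all residue vectors.\<close>

lemma mixed_variance_third_half:
  assumes card: "CARD('n::finite) \<ge> 2"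
  defines "N \<equiv> real CARD('n)"
  shows "mixed_variance TYPE('n) (1 / 3) (1 / 2)
    = 27 * (- 36821493886409 + 71724260647553 * N - 46282959184439 * N\<^sup>2 + 9902542819695 * N^3)
      / (8331019058 * (- 269171 + 524347 * N - 338381 * N\<^sup>2 + 72405 * N^3))"
proof -
  define q where "q = - 269171 + 524347 * N - 338381 * N\<^sup>2 + 72405 * N^3"
  have "2 \<le> N" using card by (simp add: N_def)
  then have "0 < q" unfolding q_def by (rule variance_denominator_pos)
  then have q: "q \<noteq> 0" by simp
  \<comment> \<open>The solution of \<open>pair_rate a b + pair_rate b a = 2 v\<close>, a 6 by 6 linear system over the rational functions of \<open>N\<close>,
    normalised by \<open>G 0 b = 0\<close>; \<open>q\<close> is the common denominator. A function of one residue can be moved from \<open>G\<close> to \<open>\<kappa>\<close>.\<close>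
  define p11 where "p11 = (21082581000 - 27149728320 * N + 8702736120 * N\<^sup>2) / 2588881"
  define p12 where "p12 = (20620257840 - 27074043360 * N + 8811943920 * N\<^sup>2) / 2588881"
  define p22 where "p22 = (14755586040 - 18309432960 * N + 5663778120 * N\<^sup>2) / 2588881"
  define pk1 where "pk1 = (- 102236345866512 + 161082643951944 * N - 79294149288432 * N\<^sup>2 + 11669426004600 * N ^ 3) / 4165509529"
  define pk2 where "pk2 = (36487289833488 - 101028128180616 * N + 83749947838128 * N\<^sup>2 - 21743483931000 * N ^ 3) / 4165509529"
  \<comment> \<open>The constants 4165509529 and 8331019058 are the cube of 1609 and twice that
    cube.\<close>
  define pv where "pv = 27 * (- 36821493886409 + 71724260647553 * N - 46282959184439 * N\<^sup>2 + 9902542819695 * N^3) / 8331019058"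
  let ?\<eta> = "triple 0 (494 / 1609) (442 / 1609) :: 3 \<Rightarrow> real"
  let ?\<kappa> = "triple 0 (pk1 / q) (pk2 / q)"
  let ?G = "triple (triple 0 0 0) (triple 0 (p11 / q) (p12 / q)) (triple 0 (p12 / q) (p22 / q))"
  have drift: "(1 - 1 / 2) * (win_prob (1 / 3) a - lose_prob (1 / 3) a) + site_gen (1 / 3) (1 / 2) ?\<eta> a = 48 / 1609" for a
    using three_cases[of a] by (elim disjE) (simp_all add: site_gen_def win_lose_prob_third three_arith)
  have sym: "?G a b = ?G b a" for a b
    using three_cases[of a] three_cases[of b] by (elim disjE) simp_all
  note poisson = mixed_variance_poisson[OF card, of "1 / 3" "1 / 2" "48 / 1609" "site_sum ?\<eta>", OF _ _ _ step_drift[OF card drift]]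
  let ?r = "pair_rate N (1 / 3) (1 / 2) (48 / 1609) ?\<eta> ?\<kappa> ?G"
  \<comment> \<open>Multiplying by \<open>q\<close> turns each equation into a polynomial identity
    in \<open>N\<close>.\<close>
  have combine: "x = 2 * (pv / q)"
    if "x = c0 + c1 * (p11 / q) + c2 * (p12 / q) + c3 * (p22 / q) + c4 * (pk1 / q) + c5 * (pk2 / q)"
      and "c0 * q + c1 * p11 + c2 * p12 + c3 * p22 + c4 * pk1 + c5 * pk2 = 2 * pv" for x c0 c1 c2 c3 c4 c5
  proof -
    have "x = (c0 * q + c1 * p11 + c2 * p12 + c3 * p22 + c4 * pk1 + c5 * pk2) / q"
      using that(1) q by (simp add: add_divide_distrib)
    then show ?thesis unfolding that(2) by simp
  qed
  note poly_simps = q_def p11_def p12_def p22_def pk1_def pk2_def pv_def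
  have r00: "?r 0 0 + ?r 0 0 = 2 * (pv / q)"
  proof (rule combine)
    show "?r 0 0 + ?r 0 0 = (2539449 / 2588881) + (11 / 10) * (p11 / q) + (2) * (p12 / q) + (19 / 10) * (p22 / q) + (11 / 10) * (pk1 / q) + (19 / 10) * (pk2 / q)"
      by (rule pair_rate_third_half(1))
    show "(2539449 / 2588881) * q + (11 / 10) * p11 + (2) * p12 + (19 / 10) * p22 + (11 / 10) * pk1 + (19 / 10) * pk2 = 2 * pv"
      unfolding poly_simps by (simp add: field_simps power2_eq_square power3_eq_cube)
  qed
  have r01: "?r 0 1 + ?r 1 0 = 2 * (pv / q)"
  proof (rule combine)
    show "?r 0 1 + ?r 1 0 = (2367342 / 2588881) + (-61 / 20 + (11 / 10) * N) * (p11 / q) + (-29 / 10 + (19 / 10) * N) * (p12 / q) + (113 / 40) * (p22 / q) + (-19 / 20) * (pk1 / q) + (73 / 40) * (pk2 / q)"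
      by (rule pair_rate_third_half(2))
    show "(2367342 / 2588881) * q + (-61 / 20 + (11 / 10) * N) * p11 + (-29 / 10 + (19 / 10) * N) * p12 + (113 / 40) * p22 + (-19 / 20) * pk1 + (73 / 40) * pk2 = 2 * pv"
      unfolding poly_simps by (simp add: field_simps power2_eq_square power3_eq_cube)
  qed
  have r02: "?r 0 2 + ?r 2 0 = 2 * (pv / q)"
  proof (rule combine)
    show "?r 0 2 + ?r 2 0 = (1792170 / 2588881) + (87 / 40) * (p11 / q) + (-21 / 10 + (11 / 10) * N) * (p12 / q) + (-69 / 20 + (19 / 10) * N) * (p22 / q) + (47 / 40) * (pk1 / q) + (-11 / 20) * (pk2 / q)"
      by (rule pair_rate_third_half(3))
    show "(1792170 / 2588881) * q + (87 / 40) * p11 + (-21 / 10 + (11 / 10) * N) * p12 + (-69 / 20 + (19 / 10) * N) * p22 + (47 / 40) * pk1 + (-11 / 20) * pk2 = 2 * pv"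
      unfolding poly_simps by (simp add: field_simps power2_eq_square power3_eq_cube)
  qed
  have r11: "?r 1 1 + ?r 1 1 = 2 * (pv / q)"
  proof (rule combine)
    show "?r 1 1 + ?r 1 1 = (3217347 / 2588881) + (5 + (-6) * N) * (p11 / q) + (-11 / 2 + (7 / 2) * N) * (p12 / q) + (7 / 4) * (p22 / q) + (-3) * (pk1 / q) + (7 / 4) * (pk2 / q)"
      by (rule pair_rate_third_half(4))
    show "(3217347 / 2588881) * q + (5 + (-6) * N) * p11 + (-11 / 2 + (7 / 2) * N) * p12 + (7 / 4) * p22 + (-3) * pk1 + (7 / 4) * pk2 = 2 * pv"
      unfolding poly_simps by (simp add: field_simps power2_eq_square power3_eq_cube)
  qed
  have r12: "?r 1 2 + ?r 2 1 = 2 * (pv / q)"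
  proof (rule combine)
    show "?r 1 2 + ?r 2 1 = (2709099 / 2588881) + (-25 / 8 + (5 / 4) * N) * (p11 / q) + (9 + (-6) * N) * (p12 / q) + (-27 / 8 + (7 / 4) * N) * (p22 / q) + (-7 / 8) * (pk1 / q) + (-5 / 8) * (pk2 / q)"
      by (rule pair_rate_third_half(5))
    show "(2709099 / 2588881) * q + (-25 / 8 + (5 / 4) * N) * p11 + (9 + (-6) * N) * p12 + (-27 / 8 + (7 / 4) * N) * p22 + (-7 / 8) * pk1 + (-5 / 8) * pk2 = 2 * pv"
      unfolding poly_simps by (simp add: field_simps power2_eq_square power3_eq_cube)
  qed
  have r22: "?r 2 2 + ?r 2 2 = 2 * (pv / q)"
  proof (rule combine)
    show "?r 2 2 + ?r 2 2 = (1774971 / 2588881) + (5 / 4) * (p11 / q) + (-9 / 2 + (5 / 2) * N) * (p12 / q) + (5 + (-6) * N) * (p22 / q) + (5 / 4) * (pk1 / q) + (-3) * (pk2 / q)"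
      by (rule pair_rate_third_half(6))
    show "(1774971 / 2588881) * q + (5 / 4) * p11 + (-9 / 2 + (5 / 2) * N) * p12 + (5 + (-6) * N) * p22 + (5 / 4) * pk1 + (-3) * pk2 = 2 * pv"
      unfolding poly_simps by (simp add: field_simps power2_eq_square power3_eq_cube)
  qed
  have rate: "?r a b + ?r b a = 2 * (pv / q)" for a b
    using three_cases[of a] three_cases[of b] r00 r01 r02 r11 r12 r22
    by (elim disjE) (simp_all only: add.commute)
  have "mixed_variance TYPE('n) (1 / 3) (1 / 2) = pv / q"
    by (rule poisson(2)[OF _ _ _ step_variance[OF card sym rate[unfolded N_def]]]) simp_all
  then show ?thesis by (simp add: pv_def q_def)
qed

section \<open>Pure transfers, and the three cases of the theorem\<close>

lemma capital_constant:
  fixes C :: "nat \<Rightarrow> 'w \<Rightarrow> 'n::finite \<Rightarrow> int"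
  assumes N: "CARD('n) \<ge> 2" and mc: "markov_chain_on M (mixed_game \<rho> 1) C"
  shows "AE \<omega> in M. capital (C n \<omega>) = capital (C 0 \<omega>)"
proof -
  obtain r where r: "\<And>n. distr M (count_space UNIV) (\<lambda>\<omega>. (C 0 \<omega>, C n \<omega>)) = measure_pmf (r n)"
    and r0: "set_pmf (r 0) \<subseteq> Id"
    and r_Suc: "\<And>n. r (Suc n) = bind_pmf (r n) (\<lambda>(a, b). map_pmf (Pair a) (mixed_game \<rho> 1 b))"
    using markov_chain_endpoints[OF mc] by blast
  have [measurable]: "C n \<in> M \<rightarrow>\<^sub>M count_space UNIV" for n
    using mc by (simp add: markov_chain_on_def)
  have "mixed_game \<rho> 1 c = game_A' c" for c :: "'n \<Rightarrow> int"
  proof -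
    have "bernoulli_pmf 1 = return_pmf True" by (rule pmf_eqI) (auto simp: pmf_return split: split_indicator)
    then show ?thesis by (simp add: mixed_game_def bind_return_pmf)
  qed
  then have step: "capital c' = capital c" if "c' \<in> set_pmf (mixed_game \<rho> 1 c)" for c c' :: "'n \<Rightarrow> int"
    using that capital_game_A'[OF N] by metis
  have "capital b = capital a" if "(a, b) \<in> set_pmf (r n)" for a b
    using that
  proof (induction n arbitrary: b)
    case (Suc n)
    then show ?case by (auto simp: r_Suc dest!: step)
  qed (use r0 in auto)
  then have "AE x in distr M (count_space UNIV) (\<lambda>\<omega>. (C 0 \<omega>, C n \<omega>)). capital (snd x) = capital (fst x)"
    unfolding r by (auto intro: AE_pmfI)
  then show ?thesis by (subst (asm) AE_distr_iff) auto
qed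

theorem theorem5:
  fixes M :: "'w measure"
    and C :: "nat \<Rightarrow> 'w \<Rightarrow> 'n::finite \<Rightarrow> int"
    and \<rho> \<gamma> :: real
  defines "S \<equiv> total_profit C"
    and "N \<equiv> real CARD('n)"
    and "\<mu> \<equiv> mixed_mean \<rho> \<gamma>"
    and "\<sigma>2 \<equiv> mixed_variance TYPE('n) \<rho> \<gamma>"
    and "\<sigma>2_B \<equiv> (3 * \<rho> / (1 + \<rho> + \<rho>\<^sup>2))\<^sup>2"
  assumes "CARD('n) \<ge> 2" and "\<rho> > 0" and "0 \<le> \<gamma>" and "\<gamma> \<le> 1"
    and "markov_chain_on M (mixed_game \<rho> \<gamma>) C"
  shows
    "(\<gamma> = 1 \<longrightarrow> measure M {\<omega> \<in> space M. \<forall>n\<ge>1. S n \<omega> = 0} = 1) \<and>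
     (\<gamma> = 0 \<longrightarrow>
        (AE \<omega> in M. (\<lambda>n. S n \<omega> / real n) \<longlonglongrightarrow> 0) \<and>
        weak_conv_m (\<lambda>n. distr M borel (\<lambda>\<omega>. S n \<omega> / sqrt (real n * \<sigma>2_B)))
          std_normal_distribution) \<and>
     (0 < \<gamma> \<and> \<gamma> < 1 \<longrightarrow>
        (AE \<omega> in M. (\<lambda>n. S n \<omega> / real n) \<longlonglongrightarrow> \<mu>) \<and>
        (\<sigma>2 > 0 \<longrightarrow>
           weak_conv_m (\<lambda>n. distr M borel (\<lambda>\<omega>. (S n \<omega> - real n * \<mu>) / sqrt (real n * \<sigma>2)))
             std_normal_distribution) \<and>
        (\<rho> = 1 / 3 \<and> \<gamma> = 1 / 2 \<longrightarrow>
           \<sigma>2 = 27 * (- 36821493886409 + 71724260647553 * N - 46282959184439 * N\<^sup>2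
                      + 9902542819695 * N^3)
                / (8331019058 * (- 269171 + 524347 * N - 338381 * N\<^sup>2 + 72405 * N^3)) \<and>
           weak_conv_m (\<lambda>n. distr M borel (\<lambda>\<omega>. (S n \<omega> - real n * \<mu>) / sqrt (real n * \<sigma>2)))
             std_normal_distribution))"
proof (intro conjI impI)
  note card = \<open>CARD('n) \<ge> 2\<close> and mc = \<open>markov_chain_on M (mixed_game \<rho> \<gamma>) C\<close>
  interpret prob_space M using mc by (simp add: markov_chain_on_def)
  have [measurable]: "C n \<in> M \<rightarrow>\<^sub>M count_space UNIV" for n
    using mc by (simp add: markov_chain_on_def)
  {
    assume "\<gamma> = 1"
    have "AE \<omega> in M. \<forall>n. capital (C n \<omega>) = capital (C 0 \<omega>)"
      using capital_constant[OF card] mc \<open>\<gamma> = 1\<close> by (subst AE_all_countable) blast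
    then have ae: "AE \<omega> in M. \<forall>n\<ge>1. S n \<omega> = 0"
      by eventually_elim (simp add: S_def total_profit_eq)
    have "{\<omega> \<in> space M. \<forall>n\<ge>1. S n \<omega> = 0} \<in> sets M"
      unfolding S_def total_profit_eq by measurable
    then show "measure M {\<omega> \<in> space M. \<forall>n\<ge>1. S n \<omega> = 0} = 1"
      by (rule prob_Collect_eq_1[THEN iffD2, OF _ ae])
  }
  {
    assume \<gamma>: "\<gamma> = 0"
    obtain \<eta> \<kappa> where \<eta>: "\<And>a. (win_prob \<rho> a - lose_prob \<rho> a) + site_gen \<rho> 0 \<eta> a = 0"
      and \<kappa>: "\<And>a. win_prob \<rho> a * (1 + \<eta> (a + 1) - \<eta> a)\<^sup>2 + lose_prob \<rho> a * (- 1 + \<eta> (a - 1) - \<eta> a)\<^sup>2 + site_gen \<rho> 0 \<kappa> a = \<sigma>2_B"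
      unfolding \<sigma>2_B_def using game_B_solution[OF \<open>\<rho> > 0\<close>] by metis
    have drift: "step \<rho> \<gamma> (\<lambda>k y. of_int k - 0 + site_sum \<eta> y - site_sum \<eta> x) x = 0" for x :: "'n \<Rightarrow> 3"
      by (rule step_drift[OF card]) (simp add: \<gamma> \<eta>)
    from game_strong_law[OF card \<open>\<rho> > 0\<close> \<open>0 \<le> \<gamma>\<close> \<open>\<gamma> \<le> 1\<close> mc drift]
    show "AE \<omega> in M. (\<lambda>n. S n \<omega> / real n) \<longlonglongrightarrow> 0" by (simp add: S_def)
    \<comment> \<open>Without transfers the squared increment involves one player only, so
      \<open>G = 0\<close> suffices and the pair rates add up to the one-player equations at
      \<open>a\<close> and at \<open>b\<close>.\<close>
    have rate: "pair_rate (real CARD('n)) \<rho> \<gamma> 0 \<eta> \<kappa> (\<lambda>_ _. 0) a b + pair_rate (real CARD('n)) \<rho> \<gamma> 0 \<eta> \<kappa> (\<lambda>_ _. 0) b a = 2 * \<sigma>2_B" for a b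
      using \<kappa>[of a] \<kappa>[of b] unfolding \<gamma> pair_rate_def self_increment_def site_gen_def lose_prob_def by (simp add: algebra_simps)
    have "0 < 3 * \<rho> / (1 + \<rho> + \<rho>\<^sup>2)" using \<open>\<rho> > 0\<close> by (simp add: add_pos_pos)
    then have "0 < \<sigma>2_B" unfolding \<sigma>2_B_def by (rule zero_less_power)
    from game_central_limit[OF card \<open>\<rho> > 0\<close> \<open>0 \<le> \<gamma>\<close> \<open>\<gamma> \<le> 1\<close> mc drift step_variance[OF card _ rate] this]
    show "weak_conv_m (\<lambda>n. distr M borel (\<lambda>\<omega>. S n \<omega> / sqrt (real n * \<sigma>2_B))) std_normal_distribution"
      by (simp add: S_def)
  }
  assume \<gamma>: "0 < \<gamma> \<and> \<gamma> < 1"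
  obtain \<eta> where "\<And>a. (1 - \<gamma>) * (win_prob \<rho> a - lose_prob \<rho> a) + site_gen \<rho> \<gamma> \<eta> a = \<mu>"
    unfolding \<mu>_def using drift_solution[OF \<open>\<rho> > 0\<close> \<open>0 \<le> \<gamma>\<close>] by metis
  then have drift: "step \<rho> \<gamma> (\<lambda>k y. of_int k - \<mu> + site_sum \<eta> y - site_sum \<eta> x) x = 0" for x :: "'n \<Rightarrow> 3"
    by (rule step_drift[OF card])
  from game_strong_law[OF card \<open>\<rho> > 0\<close> \<open>0 \<le> \<gamma>\<close> \<open>\<gamma> \<le> 1\<close> mc drift]
  show "AE \<omega> in M. (\<lambda>n. S n \<omega> / real n) \<longlonglongrightarrow> \<mu>" by (simp add: S_def)
  obtain g :: "('n \<Rightarrow> 3) \<Rightarrow> real"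
    where g: "\<And>x. step \<rho> \<gamma> (\<lambda>k y. (of_int k - \<mu> + site_sum \<eta> y - site_sum \<eta> x)\<^sup>2 + g y - g x) x = \<sigma>2"
    unfolding \<sigma>2_def using mixed_variance_poisson(1)[OF card \<open>\<rho> > 0\<close> \<open>0 \<le> \<gamma>\<close> _ drift] \<gamma> by blast
  have clt: "weak_conv_m (\<lambda>n. distr M borel (\<lambda>\<omega>. (S n \<omega> - real n * \<mu>) / sqrt (real n * \<sigma>2))) std_normal_distribution" if "\<sigma>2 > 0"
    unfolding S_def by (rule game_central_limit[OF card \<open>\<rho> > 0\<close> \<open>0 \<le> \<gamma>\<close> \<open>\<gamma> \<le> 1\<close> mc drift g that])
  then show "weak_conv_m (\<lambda>n. distr M borel (\<lambda>\<omega>. (S n \<omega> - real n * \<mu>) / sqrt (real n * \<sigma>2))) std_normal_distribution" if "\<sigma>2 > 0"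
    using that .
  assume special: "\<rho> = 1 / 3 \<and> \<gamma> = 1 / 2"
  show \<sigma>2: "\<sigma>2 = 27 * (- 36821493886409 + 71724260647553 * N - 46282959184439 * N\<^sup>2 + 9902542819695 * N^3)
      / (8331019058 * (- 269171 + 524347 * N - 338381 * N\<^sup>2 + 72405 * N^3))"
    using mixed_variance_third_half[OF card] special by (simp only: \<sigma>2_def N_def)
  have "2 \<le> N" using card by (simp add: N_def)
  then have "0 < \<sigma>2"
    unfolding \<sigma>2 by (intro divide_pos_pos mult_pos_pos variance_numerator_pos variance_denominator_pos) auto
  then show "weak_conv_m (\<lambda>n. distr M borel (\<lambda>\<omega>. (S n \<omega> - real n * \<mu>) / sqrt (real n * \<sigma>2))) std_normal_distribution"
    by (rule clt)
qed

end
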